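(* Let $H\le F_m$ be a non-cyclic free factor such that the core $\Delta_H$ has more than one vertex, and let $\varphi$ be the Whitehead automorphism given by Ascari's theorem (recalled in the context), so that $\Delta_{\varphi(H)}$ has strictly fewer vertices and strictly fewer edges than $\Delta_H$ and can be obtained from $\Delta_H$ by collapsing certain edges of $\Delta_H$. Let $\lambda$ and $\lambda_1$ be the Perron–Frobenius eigenvalues of the adjacency matrices $M$ and $M_1$ of the transition diagrams of $\mathcal{B}_H$ and $\mathcal{B}_{\varphi(H)}$, respectively. Then $\lambda<\lambda_1$.
   Context: Free group and words. $F_m$ is the free group of finite rank $m>2$ with fixed basis $X=\{x_1,\dots,x_m\}$, and $\Sigma=X\cup X^{-1}$. A word $y_1\cdots y_n$ over $\Sigma$ is reduced if $y_{i+1}\ne y_i^{-1}$ for all $i$, and cyclically reduced if moreover $y_n\ne y_1^{-1}$. Standing assumption: $H$ is a non-trivial, non-cyclic finitely generated subgroup generated by cyclically reduced words. Core. For a finitely generated $K\le F_m$, the Schreier graph has the right cosets $Kg$ as vertices and, for each coset and each $x\in X$, an edge labeled $x$ from $Kg$ to $Kgx$; its root is $v_1=K$. The core $\Delta_K$ is the subgraph that is the union of the reduced closed paths based at $v_1$ (edges may be traversed backwards, reading the inverse letter). The extended core $\widehat\Delta_K$ has the same vertices and, for each edge $e$ of $\Delta_K$ labeled $x$, both $e$ and an inverse edge $\bar e$ labeled $x^{-1}$ from the terminus of $e$ to its origin. If an edge of $\widehat\Delta_K$ labeled $z$ has origin $v$, its terminus is denoted $vz$. Automaton $\mathcal{B}_K$.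 Its states are the pairs $(v,y)$, with $v$ a vertex of $\widehat\Delta_K$ and $y\in\Sigma$, such that some edge of $\widehat\Delta_K$ labeled $y$ terminates at $v$. From $(v,y)$ there is an edge labeled $z$ to $(vz,z)$ whenever $\widehat\Delta_K$ has an edge labeled $z$ with origin $v$ and $z\ne y^{-1}$. Both the initial and the final states are all states of the form $(v_1,y)$. The automata $\mathcal{B}_H$ and $\mathcal{B}_{\varphi(H)}$ are ergodic (their transition diagrams are strongly connected), so $M$ and $M_1$ are irreducible non-negative integer matrices; the Perron–Frobenius eigenvalue is the maximal eigenvalue. Whitehead automorphism. For $a\in\Sigma$ and $A\subseteq\Sigma\setminus\{a,a^{-1}\}$, $\varphi=(A,a)$ is the automorphism of $F_m$ with $a\mapsto a$ and, for the other generators, $x_j\mapsto x_j$ if $x_j,x_j^{-1}\notin A$; $x_j\mapsto ax_j$ if $x_j\in A$, $x_j^{-1}\notin A$; $x_j\mapsto x_ja^{-1}$ if $x_j\notin A$, $x_j^{-1}\in A$; $x_j\mapsto ax_ja^{-1}$ if $x_j,x_j^{-1}\in A$. Ascari's theorem. Let $H\le F_m$ be a free factor and suppose $\Delta_H$ has more than one vertex. Then there is a Whitehead automorphism $\varphi$ such that $\Delta_{\varphi(H)}$ has strictly fewer vertices and strictly fewer edges than $\Delta_H$. Additionally, $\varphi$ can be chosen in such a way that $\Delta_{\varphi(H)}$ can be obtained from $\Delta_H$ by collapsing certain edges of $\Delta_H$. *)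

theory Defs
  imports
    "HOL-Algebra.Elementary_Groups"
    "HOL-Library.Cardinality"
    "Graph_Theory.Digraph_Isomorphism"
    "Jordan_Normal_Form.Char_Poly"
begin

text \<open>The basis \<open>X\<close> is the type \<open>'x\<close>; the letter \<open>(x, True)\<close> stands for \<open>x\<close> and
  \<open>(x, False)\<close> for its inverse, so \<open>\<Sigma>\<close> is the type \<open>'x letter\<close>.\<close>

type_synonym 'x letter = "'x \<times> bool"
type_synonym 'x word = "'x letter list"

definition inv_letter :: "'x letter \<Rightarrow> 'x letter" where
  "inv_letter y = (fst y, \<not> snd y)"

definition reduced :: "'x word \<Rightarrow> bool" where
  "reduced w \<longleftrightarrow> successively (\<lambda>y z. z \<noteq> inv_letter y) w"

definition cyclically_reduced :: "'x word \<Rightarrow> bool" where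
  "cyclically_reduced w \<longleftrightarrow> reduced w \<and> (w \<noteq> [] \<longrightarrow> last w \<noteq> inv_letter (hd w))"

fun push :: "'x letter \<Rightarrow> 'x word \<Rightarrow> 'x word" where
  "push y [] = [y]"
| "push y (z # w) = (if z = inv_letter y then w else y # z # w)"

definition reduce :: "'x word \<Rightarrow> 'x word" where
  "reduce w = foldr push w []"

definition free_group :: "'x word monoid" where
  "free_group = \<lparr>carrier = {w. reduced w}, monoid.mult = (\<lambda>u v. reduce (u @ v)), one = []\<rparr>"

lemma inv_letter_inv [simp]: "inv_letter (inv_letter y) = y"
  by (simp add: inv_letter_def)

lemma reduced_Nil [simp]: "reduced []"
  by (simp add: reduced_def)

lemma reduced_Cons:
  "reduced (y # w) \<longleftrightarrow> (w = [] \<or> hd w \<noteq> inv_letter y) \<and> reduced w"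
  by (cases w) (auto simp: reduced_def)

lemma reduced_push: "reduced w \<Longrightarrow> reduced (push y w)"
  by (cases w) (auto simp: reduced_Cons)

lemma reduced_foldr_push: "reduced w \<Longrightarrow> reduced (foldr push u w)"
  by (induction u) (auto intro: reduced_push)

lemma push_push_inv: "reduced w \<Longrightarrow> push y (push (inv_letter y) w) = w"
  by (cases w; cases "tl w") (auto simp: reduced_Cons)

lemma push_reduced: "reduced (y # w) \<Longrightarrow> push y w = y # w"
  by (cases w) (auto simp: reduced_Cons)

lemma reduce_reduced: "reduced w \<Longrightarrow> reduce w = w"
  by (induction w) (auto simp: reduce_def push_reduced, metis push_reduced reduced_Cons)

lemma foldr_push_push:
  assumes "reduced w" "reduced v"
  shows "foldr push (push y v) w = push y (foldr push v w)"
proof (cases v)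
  case (Cons z v')
  then show ?thesis
    using push_push_inv[OF reduced_foldr_push[OF assms(1)], of y v'] by auto
qed simp

lemma foldr_push_foldr:
  assumes "reduced w" "reduced v"
  shows "foldr push (foldr push u v) w = foldr push u (foldr push v w)"
  by (induction u) (auto simp: foldr_push_push reduced_foldr_push assms)

lemma mult_free_group: "reduced v \<Longrightarrow> u \<otimes>\<^bsub>free_group\<^esub> v = foldr push u v"
  using reduce_reduced[of v] by (simp add: free_group_def reduce_def)

lemma foldr_push_inverse:
  "reduced w \<Longrightarrow> foldr push (map inv_letter (rev u)) (foldr push u w) = w"
proof (induction u arbitrary: w)
  case (Cons y u)
  then show ?case
    using push_push_inv[OF reduced_foldr_push[OF Cons.prems], of "inv_letter y" u] by simp
qed simp

lemma group_free_group: "group free_group"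
proof (rule groupI)
  show "\<exists>y\<in>carrier free_group. y \<otimes>\<^bsub>free_group\<^esub> x = \<one>\<^bsub>free_group\<^esub>"
    if "x \<in> carrier free_group" for x
  proof
    let ?y = "foldr push (map inv_letter (rev x)) []"
    show "?y \<in> carrier free_group"
      by (simp add: free_group_def reduced_foldr_push)
    have x: "reduced x" "foldr push x [] = x"
      using that reduce_reduced[of x] by (auto simp: free_group_def reduce_def)
    have "?y \<otimes>\<^bsub>free_group\<^esub> x = foldr push (map inv_letter (rev x)) (foldr push x [])"
      using x by (simp add: mult_free_group foldr_push_foldr)
    then show "?y \<otimes>\<^bsub>free_group\<^esub> x = \<one>\<^bsub>free_group\<^esub>"
      using foldr_push_inverse[of "[]" x] by (simp add: free_group_def)
  qed
qed (auto simp: mult_free_group foldr_push_foldr reduced_foldr_push free_group_def reduce_reduced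
       reduce_def[symmetric], auto simp: reduce_def reduced_foldr_push foldr_push_foldr)

text \<open>\<open>G\<close> is the internal free product \<open>H * K\<close>: the two subgroups generate \<open>G\<close>, and no
  non-empty product of non-trivial elements taken alternately from \<open>H\<close> and \<open>K\<close> is trivial.
  (If some \<open>g \<noteq> \<one>\<close> lay in both, the alternating product of \<open>g\<close> and its inverse would be
  trivial; hence the alternation condition is unambiguous.)\<close>

definition internal_free_product ::
  "('a, 'b) monoid_scheme \<Rightarrow> 'a set \<Rightarrow> 'a set \<Rightarrow> bool" where
  "internal_free_product G H K \<longleftrightarrow>
     subgroup H G \<and> subgroup K G \<and> generate G (H \<union> K) = carrier G \<and>
     (\<forall>gs. gs \<noteq> [] \<and> set gs \<subseteq> (H \<union> K) - {\<one>\<^bsub>G\<^esub>} \<and>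
           successively (\<lambda>g h. g \<in> H \<and> h \<in> K \<or> g \<in> K \<and> h \<in> H) gs \<longrightarrow>
           foldr (monoid.mult G) gs \<one>\<^bsub>G\<^esub> \<noteq> \<one>\<^bsub>G\<^esub>)"

definition free_factor :: "('a, 'b) monoid_scheme \<Rightarrow> 'a set \<Rightarrow> bool" where
  "free_factor G H \<longleftrightarrow> (\<exists>K. internal_free_product G H K)"

definition whitehead_automorphism ::
  "'x letter set \<Rightarrow> 'x letter \<Rightarrow> ('x word \<Rightarrow> 'x word) \<Rightarrow> bool" where
  "whitehead_automorphism A a \<phi> \<longleftrightarrow>
     A \<subseteq> UNIV - {a, inv_letter a} \<and>
     \<phi> \<in> iso free_group free_group \<and>
     \<phi> [a] = [a] \<and>
     (\<forall>x. (x, True) \<noteq> a \<and> (x, True) \<noteq> inv_letter a \<longrightarrow>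
        ((x, True) \<notin> A \<and> (x, False) \<notin> A \<longrightarrow> \<phi> [(x, True)] = [(x, True)]) \<and>
        ((x, True) \<in> A \<and> (x, False) \<notin> A \<longrightarrow> \<phi> [(x, True)] = [a, (x, True)]) \<and>
        ((x, True) \<notin> A \<and> (x, False) \<in> A \<longrightarrow> \<phi> [(x, True)] = [(x, True), inv_letter a]) \<and>
        ((x, True) \<in> A \<and> (x, False) \<in> A \<longrightarrow> \<phi> [(x, True)] = [a, (x, True), inv_letter a]))"

text \<open>An arc labelled \<open>l\<close> from \<open>u\<close> to \<open>v\<close> is the triple \<open>(u, l, v)\<close>. No parallel arcs get
  identified, because in these graphs the origin and the label determine the arc.\<close>

type_synonym ('v, 'l) arc = "'v \<times> 'l \<times> 'v"

definition arc_label :: "('v, 'l) arc \<Rightarrow> 'l" where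
  "arc_label e = fst (snd e)"

definition labelled_digraph :: "'v set \<Rightarrow> ('v, 'l) arc set \<Rightarrow> ('v, ('v, 'l) arc) pre_digraph" where
  "labelled_digraph V E = \<lparr>verts = V, arcs = E, tail = fst, head = (\<lambda>e. snd (snd e))\<rparr>"

definition schreier_graph :: "'x word set \<Rightarrow> ('x word set, ('x word set, 'x) arc) pre_digraph" where
  "schreier_graph K = labelled_digraph (rcosets\<^bsub>free_group\<^esub> K)
     {(c, x, c #>\<^bsub>free_group\<^esub> [(x, True)]) | c x. c \<in> rcosets\<^bsub>free_group\<^esub> K}"

definition positive_arc :: "('v, 'x) arc \<Rightarrow> ('v, 'x letter) arc" where
  "positive_arc = (\<lambda>(u, x, v). (u, (x, True), v))"

definition negative_arc :: "('v, 'x) arc \<Rightarrow> ('v, 'x letter) arc" where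
  "negative_arc = (\<lambda>(u, x, v). (v, (x, False), u))"

definition inverse_arc :: "('v, 'x letter) arc \<Rightarrow> ('v, 'x letter) arc" where
  "inverse_arc = (\<lambda>(u, y, v). (v, inv_letter y, u))"

definition extended ::
  "('v, ('v, 'x) arc) pre_digraph \<Rightarrow> ('v, ('v, 'x letter) arc) pre_digraph" where
  "extended G = labelled_digraph (verts G) (positive_arc ` arcs G \<union> negative_arc ` arcs G)"

text \<open>A path that may traverse arcs backwards is a directed walk in the extended graph; it is
  reduced if it never traverses an arc and then immediately its inverse.\<close>

definition reduced_closed_path ::
  "('v, ('v, 'x) arc) pre_digraph \<Rightarrow> 'v \<Rightarrow> ('v, 'x letter) arc list \<Rightarrow> bool" where
  "reduced_closed_path G r p \<longleftrightarrow>
     pre_digraph.awalk (extended G) r p r \<and> successively (\<lambda>e f. f \<noteq> inverse_arc e) p"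

definition core :: "'x word set \<Rightarrow> ('x word set, ('x word set, 'x) arc) pre_digraph" where
  "core K = (let S = schreier_graph K in labelled_digraph
     {v. \<exists>p. reduced_closed_path S K p \<and> v \<in> set (pre_digraph.awalk_verts (extended S) K p)}
     {e \<in> arcs S. \<exists>p. reduced_closed_path S K p \<and>
                      (positive_arc e \<in> set p \<or> negative_arc e \<in> set p)})"

abbreviation extended_core ::
  "'x word set \<Rightarrow> ('x word set, ('x word set, 'x letter) arc) pre_digraph" where
  "extended_core K \<equiv> extended (core K)"

definition connected_via :: "('v, 'e) pre_digraph \<Rightarrow> 'e set \<Rightarrow> ('v \<times> 'v) set" where
  "connected_via G C =
     (arc_to_ends G ` C \<union> (arc_to_ends G ` C)\<inverse>)\<^sup>* \<inter> verts G \<times> verts G"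

definition collapse :: "('v, 'e) pre_digraph \<Rightarrow> 'e set \<Rightarrow> ('v set, 'e) pre_digraph" where
  "collapse G C =
     \<lparr>verts = verts G // connected_via G C, arcs = arcs G - C,
      tail = (\<lambda>e. connected_via G C `` {tail G e}),
      head = (\<lambda>e. connected_via G C `` {head G e})\<rparr>"

text \<open>The arcs that survive in \<open>collapse G C\<close> are arcs of \<open>G\<close> and keep their labels.\<close>

definition obtained_by_collapsing ::
  "('v, ('v, 'l) arc) pre_digraph \<Rightarrow> ('w, ('w, 'l) arc) pre_digraph \<Rightarrow> bool" where
  "obtained_by_collapsing G G' \<longleftrightarrow>
     (\<exists>C \<subseteq> arcs G. \<exists>f. pre_digraph.digraph_isomorphism (collapse G C) f \<and>
        G' = app_iso f (collapse G C) \<and>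
        (\<forall>e \<in> arcs G - C. arc_label (iso_arcs f e) = arc_label e))"

record ('s, 'l) automaton =
  states :: "'s set"
  initial :: "'s set"
  final :: "'s set"
  transitions :: "('s \<times> 'l \<times> 's) set"

definition automaton_B :: "'x word set \<Rightarrow> ('x word set \<times> 'x letter, 'x letter) automaton" where
  "automaton_B K =
     (let Q = {(v, y). v \<in> verts (extended_core K) \<and>
                       (\<exists>u. (u, y, v) \<in> arcs (extended_core K))}
      in \<lparr>states = Q,
          initial = {q \<in> Q. fst q = K},
          final = {q \<in> Q. fst q = K},
          transitions = {((v, y), z, (w, z)) | v y z w.
             (v, y) \<in> Q \<and> (v, z, w) \<in> arcs (extended_core K) \<and> z \<noteq> inv_letter y}\<rparr>)"

definition transition_diagram :: "('s, 'l) automaton \<Rightarrow> ('s, ('s, 'l) arc) pre_digraph" where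
  "transition_diagram B = labelled_digraph (states B) (transitions B)"

text \<open>The adjacency matrix is determined up to the choice of an enumeration of the vertices.\<close>

definition adjacency_matrix :: "('v, 'e) pre_digraph \<Rightarrow> int mat \<Rightarrow> bool" where
  "adjacency_matrix G M \<longleftrightarrow>
     (\<exists>vs. distinct vs \<and> set vs = verts G \<and>
        M = mat (length vs) (length vs)
              (\<lambda>(i, j). int (card {e \<in> arcs G. tail G e = vs ! i \<and> head G e = vs ! j})))"

text \<open>Complex eigenvalues are not ordered, so ``maximal'' means real and of largest modulus.\<close>

definition perron_frobenius_eigenvalue :: "int mat \<Rightarrow> real \<Rightarrow> bool" where
  "perron_frobenius_eigenvalue M r \<longleftrightarrow>
     eigenvalue (map_mat complex_of_int M) (complex_of_real r) \<and>
     (\<forall>z. eigenvalue (map_mat complex_of_int M) z \<longrightarrow> cmod z \<le> r)"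

end

(* The states of B_K correspond to the darts (oriented edges) of the core of K, and its transition
   diagram is the non-backtracking graph of that core. Since H and phi(H) are isomorphic, they have
   equally many homomorphisms to Z/2, so their cores have the same Euler characteristic; hence the
   collapsed edges form a forest and can be contracted one at a time, none of them being a loop
   when its turn comes. Contracting {c, c'} replaces the transition e -> c by the transitions from
   e to the successors of c. A vector v >= 0 with lam v <= B v therefore keeps this property when
   it is restricted to the remaining darts, and the inequality becomes strict somewhere if lam > 1.
   As H is not cyclic, the final non-backtracking graph is strongly connected, which improves the
   inequality to mu u <= B_1 u with mu > lam and u >= 0 non-zero, and Collatz--Wielandt gives
   mu <= lam_1. *)
theory Submission
  imports Defs "Jordan_Normal_Form.Spectral_Radius"
begin

section \<open>Non-backtracking graphs\<close>

text \<open>Restricting an eigenvector of the first matrix to the surviving darts does not give an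
  eigenvector of the second, and the graphs between the two cores come without a subgroup. The
  argument therefore lives in abstract dart graphs and works with the inequality B v \<ge> lam v,
  which survives a contraction because lam \<ge> 1 gives v c \<le> sum of v over the successors of
  c. An eigenvalue below 1 is replaced by 1 together with a constant vector. A single strict entry
  does not yet raise the growth rate; it has to be spread over all darts. Here the obstacle is
  orientation: an undirected connected graph such as a cycle may have a non-backtracking graph that
  splits into two parts. Double stochasticity makes a set closed in one direction closed in both,
  and a vertex with three darts joins the two orientations. The Euler characteristic is read off
  from a count: a Z/2-valued function on the arcs of a core amounts to a character of the subgroup
  and one free value at each vertex other than the root, and the number of characters is an
  isomorphism invariant.\<close>

text \<open>The inverse of the dart \<open>e\<close> is \<open>i e\<close>; the dart runs from \<open>t e\<close> to \<open>t (i e)\<close>.\<close>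

definition nb_succ :: "'d set \<Rightarrow> ('d \<Rightarrow> 'd) \<Rightarrow> ('d \<Rightarrow> 'v) \<Rightarrow> 'd \<Rightarrow> 'd set" where
  "nb_succ D i t e = {f \<in> D. t f = t (i e) \<and> f \<noteq> i e}"

text \<open>Vertices occur only as values of \<open>t\<close>. Contracting an edge thus means
  deleting two darts and replacing \<open>t\<close> by a coarser map, with the involution
  unchanged.\<close>

locale dart_graph =
  fixes D :: "'d set" and i :: "'d \<Rightarrow> 'd" and t :: "'d \<Rightarrow> 'v"
  assumes finite_D: "finite D"
    and i_closed: "e \<in> D \<Longrightarrow> i e \<in> D"
    and i_i: "e \<in> D \<Longrightarrow> i (i e) = e"
    and i_neq: "e \<in> D \<Longrightarrow> i e \<noteq> e"
begin

abbreviation succ :: "'d \<Rightarrow> 'd set" where "succ \<equiv> nb_succ D i t"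

lemma succ_subset: "succ e \<subseteq> D"
  by (auto simp: nb_succ_def)

lemma finite_succ: "finite (succ e)"
  using finite_subset[OF succ_subset finite_D] .

lemma i_eq_iff: "e \<in> D \<Longrightarrow> f \<in> D \<Longrightarrow> i e = i f \<longleftrightarrow> e = f"
  by (metis i_i)

lemma succ_flip: "e \<in> D \<Longrightarrow> f \<in> D \<Longrightarrow> f \<in> succ e \<longleftrightarrow> i e \<in> succ (i f)"
  by (auto simp: nb_succ_def i_closed i_i)

lemma card_succ_eq:
  assumes "e \<in> D" "e' \<in> D" "t (i e) = t (i e')"
  shows "card (succ e) = card (succ e')"
proof -
  have "card (succ g) = card {f \<in> D. t f = t (i g)} - 1" if "g \<in> D" for g
  proof -
    have "succ g = {f \<in> D. t f = t (i g)} - {i g}" by (auto simp: nb_succ_def)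
    then show ?thesis using that finite_D i_closed by (simp add: card_Diff_singleton)
  qed
  then show ?thesis using assms by simp
qed

end

text \<open>The three conditions say that there are no dead ends, that the undirected graph is
  connected (in terms of darts, since there is no vertex set), and that some vertex has degree at
  least three. The last one rules out a cycle, whose two orientations never meet.\<close>

locale branching_dart_graph = dart_graph +
  assumes succ_nonempty: "e \<in> D \<Longrightarrow> nb_succ D i t e \<noteq> {}"
    and connected: "\<lbrakk>S \<subseteq> D; S \<noteq> {}; \<And>e. e \<in> S \<Longrightarrow> i e \<in> S;
        \<And>e f. \<lbrakk>e \<in> S; f \<in> D; t f = t e\<rbrakk> \<Longrightarrow> f \<in> S\<rbrakk> \<Longrightarrow> S = D"
    and branch_dart: "\<exists>f1\<in>D. \<exists>f2\<in>D. \<exists>f3\<in>D. f1 \<noteq> f2 \<and> f1 \<noteq> f3 \<and> f2 \<noteq> f3 \<and> t f1 = t f2 \<and> t f1 = t f3"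
begin

text \<open>Give each transition from \<open>e\<close> the weight \<open>1 / card (succ e)\<close>. The resulting matrix is doubly
  stochastic, so no mass can enter a set which it cannot leave.\<close>

lemma succ_closed_imp_pred_closed:
  assumes T: "T \<subseteq> D" and cl: "\<And>e. e \<in> T \<Longrightarrow> succ e \<subseteq> T"
    and ef: "e \<in> D" "f \<in> succ e" "f \<in> T"
  shows "e \<in> T"
proof (rule ccontr)
  assume "e \<notin> T"
  define w where "w g = (if g \<in> D then 1 / real (card (succ g)) else 0)" for g
  have wpos: "w g > 0" if "g \<in> D" for g
    using that succ_nonempty finite_succ by (auto simp: w_def card_gt_0_iff)
  have finT: "finite T" using T finite_D finite_subset by blast
  have row: "(\<Sum>h\<in>succ g. w g) = 1" if "g \<in> D" for g
    using that succ_nonempty finite_succ by (simp add: w_def)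
  \<comment> \<open>The predecessors of \<open>h\<close> are the inverses of the successors of
    \<open>i h\<close>. They all end at the origin of \<open>h\<close>, so they have equally many
    successors and carry equal weights.\<close>
  have col: "(\<Sum>g\<in>{g\<in>D. h \<in> succ g}. w g) = 1" if h: "h \<in> D" for h
  proof -
    have eq: "{g\<in>D. h \<in> succ g} = i ` succ (i h)"
    proof (intro equalityI subsetI)
      fix g assume "g \<in> {g\<in>D. h \<in> succ g}"
      then have "i g \<in> succ (i h)" "g = i (i g)" using h succ_flip i_i by auto
      then show "g \<in> i ` succ (i h)" by blast
    next
      fix g assume "g \<in> i ` succ (i h)"
      then obtain k where k: "k \<in> succ (i h)" "g = i k" by blast
      then have "k \<in> D" using succ_subset by blast
      then show "g \<in> {g\<in>D. h \<in> succ g}"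
        using k h succ_flip[of "i k" h] i_i i_closed by auto
    qed
    have inj: "inj_on i (succ (i h))"
      using i_eq_iff succ_subset by (meson inj_onI subsetD)
    have "w g = 1 / real (card (succ (i h)))" if "g \<in> D" "h \<in> succ g" for g
    proof -
      have "t (i g) = t (i (i h))" using that h i_i by (auto simp: nb_succ_def)
      then show ?thesis using card_succ_eq[of g "i h"] that h i_closed by (simp add: w_def)
    qed
    then have "(\<Sum>g\<in>{g\<in>D. h \<in> succ g}. w g) = real (card {g\<in>D. h \<in> succ g}) * (1 / real (card (succ (i h))))"
      by simp
    also have "\<dots> = 1"
      unfolding eq card_image[OF inj] using succ_nonempty finite_succ h i_closed by simp
    finally show ?thesis .
  qed
  have "real (card T) = (\<Sum>g\<in>T. \<Sum>h\<in>succ g. w g)"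
    using row T by (simp add: subset_iff)
  also have "\<dots> = (\<Sum>g\<in>T. \<Sum>h\<in>{h\<in>T. h \<in> succ g}. w g)"
  proof (intro sum.cong refl)
    fix g assume "g \<in> T"
    then show "succ g = {h\<in>T. h \<in> succ g}" using cl by blast
  qed
  also have "\<dots> = (\<Sum>h\<in>T. \<Sum>g\<in>{g\<in>T. h \<in> succ g}. w g)"
    by (rule sum.swap_restrict) (use finT in auto)
  also have "\<dots> < (\<Sum>h\<in>T. 1)"
  proof (rule sum_strict_mono_ex1[OF finT])
    have sub: "{g\<in>T. h \<in> succ g} \<subseteq> {g\<in>D. h \<in> succ g}" for h using T by auto
    show "\<forall>h\<in>T. (\<Sum>g\<in>{g\<in>T. h \<in> succ g}. w g) \<le> 1"
    proof
      fix h assume "h \<in> T"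
      then have "(\<Sum>g\<in>{g\<in>D. h \<in> succ g}. w g) = 1" using col T by auto
      moreover have "(\<Sum>g\<in>{g\<in>T. h \<in> succ g}. w g) \<le> (\<Sum>g\<in>{g\<in>D. h \<in> succ g}. w g)"
        by (rule sum_mono2) (use sub finite_D wpos in \<open>auto simp: less_imp_le\<close>)
      ultimately show "(\<Sum>g\<in>{g\<in>T. h \<in> succ g}. w g) \<le> 1" by simp
    qed
    \<comment> \<open>The predecessor \<open>e\<close> of \<open>f\<close> lies outside
      \<open>T\<close>, so its positive weight is missing from the column of
      \<open>f\<close>.\<close>
    have "(\<Sum>g\<in>{g\<in>T. f \<in> succ g}. w g) < (\<Sum>g\<in>{g\<in>D. f \<in> succ g}. w g)"
      by (rule sum_strict_mono2[of _ _ e]) (use sub finite_D wpos ef \<open>e \<notin> T\<close> in \<open>auto simp: less_imp_le\<close>)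
    then show "\<exists>h\<in>T. (\<Sum>g\<in>{g\<in>T. h \<in> succ g}. w g) < 1"
      using col ef T by (metis subsetD)
  qed
  finally show False by simp
qed

text \<open>The complement of \<open>S\<close> is closed under successors, hence also under
  predecessors by double stochasticity, so \<open>S\<close> is closed in both directions. It remains
  to exclude that \<open>S\<close> is one of two separate orientations of the graph.\<close>

lemma irreducible:
  assumes S: "S \<subseteq> D" "S \<noteq> {}" and pred: "\<And>e f. \<lbrakk>e \<in> D; f \<in> succ e; f \<in> S\<rbrakk> \<Longrightarrow> e \<in> S"
  shows "S = D"
proof -
  have succ_cl: "f \<in> S" if "e \<in> S" "f \<in> succ e" for e f
  proof (rule ccontr)
    assume "f \<notin> S"
    have "e \<in> D - S"
      by (rule succ_closed_imp_pred_closed[of "D - S" e f])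
        (use S pred that \<open>f \<notin> S\<close> succ_subset in blast)+
    then show False using that by blast
  qed
  have nb: "f \<in> succ (i e)" if "e \<in> D" "f \<in> D" "t f = t e" "f \<noteq> e" for e f
    using that by (auto simp: nb_succ_def i_i)
  have fwd: "f \<in> S" if "i e \<in> S" "e \<in> D" "f \<in> D" "t f = t e" "f \<noteq> e" for e f
    using succ_cl nb that by metis
  have bwd: "i e \<in> S" if "f \<in> S" "e \<in> D" "f \<in> D" "t f = t e" "f \<noteq> e" for e f
    using pred nb that i_closed by metis
  \<comment> \<open>\<open>F\<close> collects the edges with both orientations in \<open>S\<close>.
    Closure in both directions makes \<open>F\<close> invariant under changing the dart at a vertex,
    so it is empty or everything.\<close>
  define F where "F = {e \<in> S. i e \<in> S}"
  have *: "F = D" if "F \<noteq> {}"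
  proof (rule connected)
    fix e f assume ef: "e \<in> F" "f \<in> D" "t f = t e"
    show "f \<in> F"
    proof (cases "f = e")
      case False
      have "e \<in> D" "e \<in> S" "i e \<in> S" using ef S unfolding F_def by auto
      then show ?thesis using fwd[of e f] bwd[of e f] ef False unfolding F_def by auto
    qed (use ef in simp)
  qed (use S that i_i in \<open>auto simp: F_def\<close>)
  have "F \<noteq> {}"
  proof
    assume "F = {}"
    have all: "S \<union> i ` S = D"
    proof (rule connected)
      show "S \<union> i ` S \<subseteq> D" "S \<union> i ` S \<noteq> {}" using S i_closed by auto
    next
      fix e assume "e \<in> S \<union> i ` S"
      then show "i e \<in> S \<union> i ` S" using S i_i by auto
    next
      fix e f assume ef: "e \<in> S \<union> i ` S" "f \<in> D" "t f = t e"
      have eD: "e \<in> D" using ef S i_closed by auto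
      show "f \<in> S \<union> i ` S"
      proof (cases "f = e")
        case False
        from ef(1) consider "e \<in> S" | "i e \<in> S" using S i_i by auto
        then show ?thesis
        proof cases
          case 1
          then have "i f \<in> S" using bwd[of e f] ef eD False by metis
          then show ?thesis using i_i[OF \<open>f \<in> D\<close>] by (metis UnI2 imageI)
        next
          case 2
          then show ?thesis using fwd[of e f] ef eD False by blast
        qed
      qed (use ef in simp)
    qed
    obtain f1 f2 f3 where f: "f1 \<in> D" "f2 \<in> D" "f3 \<in> D" "f1 \<noteq> f2" "f1 \<noteq> f3" "f2 \<noteq> f3"
      "t f1 = t f2" "t f1 = t f3"
      using branch_dart by blast
    \<comment> \<open>Three darts at one vertex mix the orientations: arriving along one of them
      allows leaving along either of the other two, and what leaves along the third can be reached
      by arriving along the second.\<close>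
    from all f(1) consider "f1 \<in> S" | "i f1 \<in> S" using S i_i by auto
    then have "f3 \<in> S \<and> i f3 \<in> S"
    proof cases
      case 1
      then have "i f2 \<in> S" "i f3 \<in> S" using bwd[of f1] f by metis+
      then show ?thesis using fwd[of f2 f3] f by metis
    next
      case 2
      then have "f2 \<in> S" "f3 \<in> S" using fwd[of f1] f by metis+
      then show ?thesis using bwd[of f2 f3] f by metis
    qed
    then show False using \<open>F = {}\<close> F_def by blast
  qed
  then have "F = D" by (rule *)
  then show ?thesis using S unfolding F_def by blast
qed

text \<open>Induction on the number of darts where the inequality is tight. Writing B for the
  successor sum, the slack B v - lam v commutes with I + B, so passing from v to v + B v adds to the
  slack of each dart the slack of its successors. By irreducibility some tight dart has a successor
  with positive slack as long as tight darts exist.\<close>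

lemma subinvariant_improve:
  fixes v :: "'a \<Rightarrow> real"
  assumes lam: "lam > 0" and v0: "\<And>d. d \<in> D \<Longrightarrow> v d \<ge> 0"
    and sub: "\<And>d. d \<in> D \<Longrightarrow> lam * v d \<le> sum v (succ d)"
    and strict: "\<exists>d\<in>D. lam * v d < sum v (succ d)"
  shows "\<exists>\<mu> > lam. \<exists>u. (\<forall>d\<in>D. u d \<ge> 0 \<and> \<mu> * u d \<le> sum u (succ d)) \<and> (\<exists>d\<in>D. u d > 0)"
  using v0 sub strict
proof (induction "card {d\<in>D. \<not> lam * v d < sum v (succ d)}" arbitrary: v rule: less_induct)
  case less
  define w where "w v d = sum v (succ d) - lam * v d" for v :: "'a \<Rightarrow> real" and d
  define S where "S = {d\<in>D. w v d > 0}"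
  have w0: "w v d \<ge> 0" if "d \<in> D" for d using less.prems(2)[OF that] by (simp add: w_def)
  show ?case
  proof (cases "S = D")
    case True
    have D: "finite D" "D \<noteq> {}" using finite_D less.prems(3) by auto
    \<comment> \<open>Every entry of \<open>v\<close> is at most \<open>sum v D\<close>, so this
      \<epsilon> keeps \<epsilon> times any entry below the minimal slack; the summand 1 keeps the
      denominator positive.\<close>
    define \<epsilon> where "\<epsilon> = Min (w v ` D) / (1 + sum v D)"
    have sv: "sum v D \<ge> 0" by (rule sum_nonneg) (use less.prems in auto)
    have m: "Min (w v ` D) > 0" using D True by (auto simp: S_def)
    have eps: "\<epsilon> > 0" using m sv by (simp add: \<epsilon>_def)
    have "(lam + \<epsilon>) * v d \<le> sum v (succ d)" if d: "d \<in> D" for d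
    proof -
      have "v d \<le> sum v D" using d D less.prems by (intro member_le_sum) auto
      then have "\<epsilon> * v d \<le> \<epsilon> * (1 + sum v D)" using eps by (intro mult_left_mono) auto
      also have "\<dots> = Min (w v ` D)" using sv by (simp add: \<epsilon>_def)
      also have "\<dots> \<le> w v d" using D d by simp
      finally show ?thesis by (simp add: w_def algebra_simps)
    qed
    moreover have "\<exists>d\<in>D. v d > 0"
    proof (rule ccontr)
      assume "\<not> ?thesis"
      then have "v d = 0" if "d \<in> D" for d using less.prems(1) that by force
      then have "sum v (succ d) = 0" for d using succ_subset by (meson subsetD sum.neutral)
      then show False using less.prems(3) lam \<open>\<And>d. d \<in> D \<Longrightarrow> v d = 0\<close> by auto
    qed
    ultimately show ?thesis using eps less.prems(1) by (intro exI[of _ "lam + \<epsilon>"]) auto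
  next
    case False
    define v' where "v' d = v d + sum v (succ d)" for d
    have w': "w v' d = w v d + sum (w v) (succ d)" for d
      by (simp add: w_def v'_def sum.distrib sum_subtractf sum_distrib_left algebra_simps)
    have s0: "sum (w v) (succ d) \<ge> 0" for d
      by (rule sum_nonneg) (use w0 succ_subset in blast)
    have "S \<noteq> {}" "S \<subseteq> D" using less.prems(3) by (auto simp: S_def w_def)
    then obtain e f where ef: "e \<in> D" "f \<in> succ e" "f \<in> S" "e \<notin> S"
      using irreducible[of S] False by blast
    have "sum (w v) (succ e) > 0"
      by (rule sum_pos2[of _ f]) (use ef w0 succ_subset finite_succ in \<open>auto simp: S_def\<close>)
    then have e': "w v' e > 0" using w' w0 ef by (simp add: add_nonneg_pos)
    have "{d\<in>D. \<not> lam * v' d < sum v' (succ d)} \<subset> {d\<in>D. \<not> lam * v d < sum v (succ d)}"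
    proof
      show "{d\<in>D. \<not> lam * v' d < sum v' (succ d)} \<subseteq> {d\<in>D. \<not> lam * v d < sum v (succ d)}"
        using w' s0 w0 by (smt (verit) Collect_mono w_def)
      show "{d\<in>D. \<not> lam * v' d < sum v' (succ d)} \<noteq> {d\<in>D. \<not> lam * v d < sum v (succ d)}"
        using ef e' by (auto simp: S_def w_def)
    qed
    then have lt: "card {d\<in>D. \<not> lam * v' d < sum v' (succ d)} < card {d\<in>D. \<not> lam * v d < sum v (succ d)}"
      by (intro psubset_card_mono) (use finite_D in auto)
    show ?thesis
    proof (rule less.hyps[OF lt])
      fix d assume d: "d \<in> D"
      have "sum v (succ d) \<ge> 0" by (rule sum_nonneg) (use less.prems(1) succ_subset in blast)
      then show "0 \<le> v' d" using less.prems(1) d by (simp add: v'_def)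
      show "lam * v' d \<le> sum v' (succ d)" using w'[of d] w0[OF d] s0[of d] by (simp add: w_def)
    next
      show "\<exists>d\<in>D. lam * v' d < sum v' (succ d)" using e' ef by (auto simp: w_def)
    qed
  qed
qed

text \<open>If a successor of \<open>e\<close> has a positive entry, the eigenvalue equation makes
  the entry at \<open>e\<close> positive. The support is thus closed under predecessors.\<close>

lemma subinvariant_positive:
  fixes v :: "'a \<Rightarrow> real"
  assumes lam: "lam > 0" and v0: "\<And>d. d \<in> D \<Longrightarrow> v d \<ge> 0"
    and inv: "\<And>d. d \<in> D \<Longrightarrow> lam * v d = sum v (succ d)"
    and nz: "\<exists>d\<in>D. v d > 0" and d: "d \<in> D"
  shows "v d > 0"
proof -
  have "{d\<in>D. v d > 0} = D"
  proof (rule irreducible)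
    fix e f assume ef: "e \<in> D" "f \<in> succ e" "f \<in> {d\<in>D. v d > 0}"
    have "sum v (succ e) > 0"
      by (rule sum_pos2[of _ f]) (use ef v0 succ_subset finite_succ in auto)
    then show "e \<in> {d\<in>D. v d > 0}" using inv[of e] ef(1) lam zero_less_mult_pos[of lam "v e"] by simp
  qed (use nz in auto)
  then show ?thesis using d by blast
qed

end

section \<open>Contraction of an edge\<close>

text \<open>Only the fibres of \<open>t'\<close> are prescribed: it merges the two ends of the edge
  \<open>{c, i c}\<close> and nothing else. Any naming of the new vertices is therefore
  admissible.\<close>

locale edge_contraction = branching_dart_graph +
  fixes c :: 'a and t' :: "'a \<Rightarrow> 'c"
  assumes c: "c \<in> D" and nonloop: "t c \<noteq> t (i c)"
    and t': "\<lbrakk>e \<in> D; f \<in> D\<rbrakk> \<Longrightarrow>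
       t' e = t' f \<longleftrightarrow> t e = t f \<or> {t e, t f} = {t c, t (i c)}"
begin

abbreviation "D' \<equiv> D - {c, i c}"
abbreviation "succ' \<equiv> nb_succ D' i t'"

lemma ic: "i c \<in> D" "i (i c) = c" "i c \<noteq> c"
  using c i_closed i_i i_neq by auto

lemma D'_i: "e \<in> D' \<Longrightarrow> i e \<in> D'"
  using c i_closed i_i ic i_eq_iff by (metis Diff_iff empty_iff insert_iff)

sublocale contracted: dart_graph D' i t'
  by unfold_locales (use finite_D i_i i_neq D'_i in auto)

lemma succ_c: "succ c \<subseteq> D'" "succ (i c) \<subseteq> D'"
  using nonloop ic by (auto simp: nb_succ_def)

lemma succ'_other:
  assumes "e \<in> D'" "t (i e) \<noteq> t c" "t (i e) \<noteq> t (i c)"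
  shows "succ' e = succ e"
  using assms t'[OF _ i_closed[of e]] by (auto simp: nb_succ_def doubleton_eq_iff)

lemma succ'_tail:
  assumes "e \<in> D'" "t (i e) = t c"
  shows "succ' e = (succ e - {c}) \<union> succ c"
  using assms t'[OF _ i_closed[of e]] D'_i[OF assms(1)] ic nonloop
  by (auto simp: nb_succ_def doubleton_eq_iff)

lemma succ'_head:
  assumes "e \<in> D'" "t (i e) = t (i c)"
  shows "succ' e = (succ e - {i c}) \<union> succ (i c)"
  using assms t'[OF _ i_closed[of e]] D'_i[OF assms(1)] ic nonloop
  by (auto simp: nb_succ_def doubleton_eq_iff)

lemma sum_succ'_tail:
  fixes v :: "'a \<Rightarrow> real"
  assumes "e \<in> D'" "t (i e) = t c"
  shows "sum v (succ' e) = sum v (succ e) - v c + sum v (succ c)"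
proof -
  have "c \<in> succ e" using assms c D'_i[of e] by (auto simp: nb_succ_def)
  moreover have "(succ e - {c}) \<inter> succ c = {}" using assms nonloop by (auto simp: nb_succ_def)
  ultimately show ?thesis
    by (simp add: succ'_tail[OF assms] sum.union_disjoint finite_succ sum_diff1)
qed

lemma sum_succ'_head:
  fixes v :: "'a \<Rightarrow> real"
  assumes "e \<in> D'" "t (i e) = t (i c)"
  shows "sum v (succ' e) = sum v (succ e) - v (i c) + sum v (succ (i c))"
proof -
  have "i c \<in> succ e" using assms ic D'_i[of e] by (auto simp: nb_succ_def)
  moreover have "(succ e - {i c}) \<inter> succ (i c) = {}" using assms nonloop ic by (auto simp: nb_succ_def)
  ultimately show ?thesis
    by (simp add: succ'_head[OF assms] sum.union_disjoint finite_succ sum_diff1)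
qed

text \<open>From lam \<ge> 1 one gets \<open>v c \<le> lam * v c \<le> sum v (succ c)\<close>, so
  replacing the summand \<open>v c\<close> by the entries at the successors of \<open>c\<close>
  cannot lower the sum. The same holds for \<open>i c\<close>.\<close>

lemma subinvariant_contraction:
  fixes v :: "'a \<Rightarrow> real"
  assumes lam: "lam \<ge> 1" and v0: "\<And>d. d \<in> D \<Longrightarrow> v d \<ge> 0"
    and sub: "\<And>d. d \<in> D \<Longrightarrow> lam * v d \<le> sum v (succ d)"
    and d: "d \<in> D'"
  shows "lam * v d \<le> sum v (succ' d)"
proof -
  have *: "v e \<le> sum v (succ e)" if "e \<in> D" for e
    using sub[OF that] mult_right_mono[OF lam v0[OF that]] by linarith
  consider "t (i d) = t c" | "t (i d) = t (i c)" | "t (i d) \<noteq> t c" "t (i d) \<noteq> t (i c)" by blast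
  then show ?thesis
  proof cases
    case 1
    then show ?thesis using sum_succ'_tail[OF d 1, of v] *[OF c] sub[of d] d by simp
  next
    case 2
    then show ?thesis using sum_succ'_head[OF d 2, of v] *[OF ic(1)] sub[of d] d by simp
  next
    case 3
    then show ?thesis using succ'_other[OF d 3] sub[of d] d by simp
  qed
qed

text \<open>All successors of \<open>c\<close> and \<open>i c\<close> survive, because the edge is
  not a loop. If \<open>v\<close> vanished on them, the inequality at the two deleted darts would
  force \<open>v\<close> to vanish there too.\<close>

lemma nonzero_contraction:
  fixes v :: "'a \<Rightarrow> real"
  assumes lam: "lam > 0" and v0: "\<And>d. d \<in> D \<Longrightarrow> v d \<ge> 0"
    and sub: "\<And>d. d \<in> D \<Longrightarrow> lam * v d \<le> sum v (succ d)"
    and nz: "\<exists>d\<in>D. v d > 0"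
  shows "\<exists>d\<in>D'. v d > 0"
proof (rule ccontr)
  assume "\<not> ?thesis"
  then have z: "v d = 0" if "d \<in> D'" for d using v0 that by (metis DiffD1 order_le_less)
  have "sum v (succ c) = 0" "sum v (succ (i c)) = 0"
    using z succ_c by (meson subsetD sum.neutral)+
  then have "v c \<le> 0" "v (i c) \<le> 0"
    using sub[OF c] sub[OF ic(1)] lam by (simp_all add: mult_le_0_iff)
  then show False using nz z by (metis DiffI empty_iff insert_iff less_le_not_le order_less_irrefl)
qed

lemma incoming:
  obtains e where "e \<in> D'" "t (i e) = t c"
proof -
  obtain g where g: "g \<in> succ (i c)" using succ_nonempty ic(1) by blast
  then have gD: "g \<in> D'" "t g = t c" using succ_c ic by (auto simp: nb_succ_def)
  then show ?thesis using that[of "i g"] D'_i i_i by auto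
qed

text \<open>Take a dart \<open>e\<close> ending at the origin of \<open>c\<close>. Without a gain at
  \<open>e\<close>, the entries at the successors of \<open>c\<close> sum to at most
  \<open>v c\<close>, while they sum to at least \<open>lam * v c\<close>; for lam > 1 this is
  impossible once they are positive. Zero entries could hide the gain, which is why they form the
  other alternative.\<close>

lemma contraction_strict:
  fixes v :: "'a \<Rightarrow> real"
  assumes lam: "lam > 1" and v0: "\<And>d. d \<in> D \<Longrightarrow> v d \<ge> 0"
    and sub: "\<And>d. d \<in> D \<Longrightarrow> lam * v d \<le> sum v (succ d)"
  shows "\<exists>d\<in>D'. v d = 0 \<or> lam * v d < sum v (succ' d)"
proof (rule ccontr)
  assume neg: "\<not> ?thesis"
  then have pos: "v d > 0" if "d \<in> D'" for d using v0 that by (metis DiffD1 order_le_less)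
  obtain e where e: "e \<in> D'" "t (i e) = t c" by (rule incoming)
  have "sum v (succ c) > 0"
    by (rule sum_pos) (use pos succ_c finite_succ succ_nonempty[OF c] in auto)
  moreover have "lam * v c \<le> sum v (succ c)" using sub c by blast
  moreover have "sum v (succ c) \<le> v c"
    using neg e sum_succ'_tail[OF e, of v] sub[of e] by force
  moreover from calculation have "v c > 0" by linarith
  ultimately show False using mult_strict_right_mono[OF lam, of "v c"] by linarith
qed

lemma contracted_branching: "branching_dart_graph D' i t'"
proof
  fix e assume e: "e \<in> D'"
  consider "t (i e) = t c" | "t (i e) = t (i c)" | "t (i e) \<noteq> t c" "t (i e) \<noteq> t (i c)" by blast
  then show "succ' e \<noteq> {}"
  proof cases
    case 1 then show ?thesis using succ'_tail[OF e 1] succ_nonempty[OF c] by blast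
  next
    case 2 then show ?thesis using succ'_head[OF e 2] succ_nonempty[OF ic(1)] by blast
  next
    case 3 then show ?thesis using succ'_other[OF e 3] succ_nonempty e by blast
  qed
next
  fix S assume S: "S \<subseteq> D'" "S \<noteq> {}" and cl: "\<And>e. e \<in> S \<Longrightarrow> i e \<in> S"
    and t_cl: "\<And>e f. \<lbrakk>e \<in> S; f \<in> D'; t' f = t' e\<rbrakk> \<Longrightarrow> f \<in> S"
  have t_imp: "t' f = t' e" if "t f = t e" "e \<in> D" "f \<in> D" for e f using t' that by blast
  show "S = D'"
  proof (cases "\<exists>e\<in>S. t e \<in> {t c, t (i c)}")
    case True
    then obtain e where e: "e \<in> S" "t e \<in> {t c, t (i c)}" by blast
    have merged: "f \<in> S" if "f \<in> D'" "t f \<in> {t c, t (i c)}" for f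
    proof (rule t_cl[OF e(1) that(1)])
      show "t' f = t' e" using t'[of f e] e that S by (auto simp: doubleton_eq_iff)
    qed
    \<comment> \<open>When \<open>S\<close> meets the merged vertex it contains every surviving dart
      there, so adding the contracted edge gives a set that is closed in the original graph.\<close>
    have "S \<union> {c, i c} = D"
    proof (rule connected)
      fix e f assume ef: "e \<in> S \<union> {c, i c}" "f \<in> D" "t f = t e"
      show "f \<in> S \<union> {c, i c}"
      proof (cases "f \<in> {c, i c} \<or> e \<in> {c, i c}")
        case True
        then show ?thesis using merged[of f] ef by auto
      next
        case False
        then have "f \<in> D'" "e \<in> S" using ef by auto
        then have "f \<in> S" using t_cl[of e f] t_imp[of f e] ef S by blast
        then show ?thesis by blast
      qed
    qed (use S c ic cl in auto)
    then show ?thesis using S by blast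
  next
    case False
    have "S = D"
    proof (rule connected)
      fix e f assume ef: "e \<in> S" "f \<in> D" "t f = t e"
      then have "f \<in> D'" using False by auto
      then show "f \<in> S" using t_cl[of e f] t_imp[of f e] ef S by blast
    qed (use S cl in auto)
    then show ?thesis using S c by blast
  qed
next
  define E where "E g = {f \<in> D'. t' f = t' g}" for g
  obtain f1 f2 f3 where f: "f1 \<in> D" "f2 \<in> D" "f3 \<in> D" "f1 \<noteq> f2" "f1 \<noteq> f3" "f2 \<noteq> f3"
    "t f1 = t f2" "t f1 = t f3"
    using branch_dart by blast
  show "\<exists>f1\<in>D'. \<exists>f2\<in>D'. \<exists>f3\<in>D'. f1 \<noteq> f2 \<and> f1 \<noteq> f3 \<and> f2 \<noteq> f3 \<and> t' f1 = t' f2 \<and> t' f1 = t' f3"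
  proof (cases "{f1, f2, f3} \<inter> {c, i c} = {}")
    case True
    then show ?thesis using f t'[of f1 f2] t'[of f1 f3] by (intro bexI[of _ f1] bexI[of _ f2] bexI[of _ f3]) auto
  next
    case False
    \<comment> \<open>If the contracted dart \<open>b\<close> is one of the three at the branching
      vertex, a successor \<open>h\<close> of \<open>b\<close> takes its place: it starts at the
      other end of \<open>b\<close>, which is now the same vertex. It differs from \<open>g1\<close>
      and \<open>g2\<close> because the two ends were distinct before.\<close>
    have *: ?thesis if b: "b \<in> {c, i c}" "g1 \<in> D" "g2 \<in> D" "g1 \<noteq> b" "g2 \<noteq> b" "g1 \<noteq> g2" "t g1 = t b" "t g2 = t b" for b g1 g2
    proof -
      have bD: "b \<in> D" "i b \<in> D" "{t b, t (i b)} = {t c, t (i c)}" "t b \<noteq> t (i b)" "{b, i b} = {c, i c}"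
        using b(1) c ic nonloop by auto
      obtain h where h: "h \<in> succ b" using succ_nonempty bD by blast
      have "h \<in> D'" using h b(1) succ_c by blast
      have th: "t h = t (i b)" using h by (auto simp: nb_succ_def)
      have g: "g1 \<in> D'" "g2 \<in> D'" using b bD by auto
      have "t' g1 = t' g2" "t' g1 = t' h" "h \<noteq> g1" "h \<noteq> g2"
        using t'[of g1 g2] t'[of g1 h] b bD th \<open>h \<in> D'\<close> by auto
      then show ?thesis using g \<open>h \<in> D'\<close> b(6) by metis
    qed
    from False consider "f1 \<in> {c, i c}" | "f2 \<in> {c, i c}" | "f3 \<in> {c, i c}" by blast
    then show ?thesis
    proof cases
      case 1 then show ?thesis using *[of f1 f2 f3] f by auto
    next
      case 2 then show ?thesis using *[of f2 f1 f3] f by auto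
    next
      case 3 then show ?thesis using *[of f3 f1 f2] f by auto
    qed
  qed
qed

end

section \<open>Perron--Frobenius eigenvalues\<close>

lemma eigenvalue_smult:
  fixes A :: "complex mat"
  assumes A: "A \<in> carrier_mat n n" and c: "c \<noteq> 0" and ev: "eigenvalue (c \<cdot>\<^sub>m A) z"
  shows "eigenvalue A (z / c)"
proof -
  obtain v where v: "v \<in> carrier_vec n" "v \<noteq> 0\<^sub>v n" "(c \<cdot>\<^sub>m A) *\<^sub>v v = z \<cdot>\<^sub>v v"
    using ev A unfolding eigenvalue_def eigenvector_def by auto
  have "(c \<cdot>\<^sub>m A) *\<^sub>v v = c \<cdot>\<^sub>v (A *\<^sub>v v)"
    using v(1) A by (intro eq_vecI) (auto simp: scalar_prod_def sum_distrib_left mult.assoc)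
  then have "c \<cdot>\<^sub>v (A *\<^sub>v v) = z \<cdot>\<^sub>v v" using v(3) by simp
  then have "(1 / c) \<cdot>\<^sub>v (c \<cdot>\<^sub>v (A *\<^sub>v v)) = (1 / c) \<cdot>\<^sub>v (z \<cdot>\<^sub>v v)" by simp
  then have "A *\<^sub>v v = (z / c) \<cdot>\<^sub>v v" using c by (simp add: smult_smult_assoc)
  then show ?thesis using v A unfolding eigenvalue_def eigenvector_def by auto
qed

text \<open>Collatz--Wielandt: if \<open>\<mu>\<close> exceeded the spectral radius, the powers of the matrix scaled by
  some \<open>\<nu>\<close> in between would be bounded, although they expand \<open>v\<close> by \<open>(\<mu> / \<nu>)^k\<close>.\<close>

lemma collatz_wielandt:
  fixes A :: "int mat" and v :: "nat \<Rightarrow> real"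
  assumes A: "A \<in> carrier_mat n n" and nonneg: "\<And>i j. i < n \<Longrightarrow> j < n \<Longrightarrow> A $$ (i, j) \<ge> 0"
    and pf: "perron_frobenius_eigenvalue A r"
    and v0: "\<And>i. i < n \<Longrightarrow> v i \<ge> 0" and nz: "k < n" "v k > 0"
    and sub: "\<And>i. i < n \<Longrightarrow> \<mu> * v i \<le> (\<Sum>j<n. A $$ (i, j) * v j)"
  shows "\<mu> \<le> r"
proof (rule ccontr)
  assume "\<not> \<mu> \<le> r"
  \<comment> \<open>The number \<open>r\<close> is itself an eigenvalue, so the bound on moduli
    applies to it and shows that it is non-negative.\<close>
  have "cmod (complex_of_real r) \<le> r"
    using pf by (auto simp: perron_frobenius_eigenvalue_def)
  then have r0: "r \<ge> 0" by (smt (verit) norm_ge_zero)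
  obtain \<nu> where \<nu>: "r < \<nu>" "\<nu> < \<mu>" using \<open>\<not> \<mu> \<le> r\<close> dense[of r \<mu>] by auto
  define B where "B = complex_of_real (1 / \<nu>) \<cdot>\<^sub>m map_mat complex_of_int A"
  have B: "B \<in> carrier_mat n n" using A by (simp add: B_def)
  have Bij: "B $$ (i, j) = complex_of_real (A $$ (i, j) / \<nu>)" if "i < n" "j < n" for i j
    using that A by (simp add: B_def)
  have n0: "n > 0" using nz by auto
  have "spectral_radius B < 1"
  proof -
    obtain z where z: "spectral_radius B = cmod z" "eigenvalue B z"
      using spectral_radius_mem_max(1)[OF B n0] by (auto simp: spectrum_def)
    have "eigenvalue (map_mat complex_of_int A) (z / complex_of_real (1 / \<nu>))"
      using eigenvalue_smult[of "map_mat complex_of_int A" n "complex_of_real (1 / \<nu>)" z] z(2) A \<nu> r0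
      by (auto simp: B_def)
    then have "cmod (z / complex_of_real (1 / \<nu>)) \<le> r"
      using pf unfolding perron_frobenius_eigenvalue_def by blast
    then have "cmod z * \<nu> \<le> r" using \<nu> r0 by (simp add: norm_mult)
    then show ?thesis using z \<nu> r0 by (smt (verit) mult_less_cancel_right2)
  qed
  \<comment> \<open>Spectral radius below 1 bounds the entries of all powers of \<open>B\<close> by
    one constant, uniformly in the exponent.\<close>
  then obtain b where b: "\<And>k. norm_bound (B ^\<^sub>m k) b"
    using spectral_radius_jnf_norm_bound_less_1_upper_triangular[OF B] by blast
  define x where "x = vec n (\<lambda>i. complex_of_real (v i))"
  define q where "q = \<mu> / \<nu>"
  have q: "q > 1" using \<nu> r0 by (simp add: q_def)
  have x: "x \<in> carrier_vec n" by (simp add: x_def)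
  \<comment> \<open>\<open>B ^\<^sub>m Suc m\<close> unfolds with the new factor on the right,
    whereas the induction below applies it on the left of the vector already computed.\<close>
  have comm: "B ^\<^sub>m m * B = B * B ^\<^sub>m m" for m
  proof (induction m)
    case 0
    then show ?case using B by simp
  next
    case (Suc m)
    then show ?case
      using assoc_mult_mat[OF B pow_carrier_mat[OF B] B] by simp
  qed
  have grow: "\<exists>u. (\<forall>i<n. ((B ^\<^sub>m m) *\<^sub>v x) $ i = complex_of_real (u i) \<and> u i \<ge> q ^ m * v i)" for m
  proof (induction m)
    case 0
    show ?case by (rule exI[of _ v]) (use B x in \<open>auto simp: x_def\<close>)
  next
    case (Suc m)
    then obtain u where u: "\<And>i. i < n \<Longrightarrow> ((B ^\<^sub>m m) *\<^sub>v x) $ i = complex_of_real (u i)"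
      "\<And>i. i < n \<Longrightarrow> u i \<ge> q ^ m * v i" by blast
    define u' where "u' i = (\<Sum>j<n. A $$ (i, j) / \<nu> * u j)" for i
    have "(B ^\<^sub>m Suc m) *\<^sub>v x = B *\<^sub>v ((B ^\<^sub>m m) *\<^sub>v x)"
      using assoc_mult_mat_vec[OF B pow_carrier_mat[OF B] x] comm[of m] by simp
    moreover have "(B *\<^sub>v ((B ^\<^sub>m m) *\<^sub>v x)) $ i = complex_of_real (u' i)" if i: "i < n" for i
    proof -
      have "(B *\<^sub>v ((B ^\<^sub>m m) *\<^sub>v x)) $ i = (\<Sum>j<n. B $$ (i, j) * ((B ^\<^sub>m m) *\<^sub>v x) $ j)"
        using B i by (simp add: scalar_prod_def atLeast0LessThan)
      also have "\<dots> = (\<Sum>j<n. complex_of_real (A $$ (i, j) / \<nu> * u j))"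
        by (intro sum.cong refl) (use i Bij u in simp)
      finally show ?thesis by (simp add: u'_def)
    qed
    moreover have "u' i \<ge> q ^ Suc m * v i" if i: "i < n" for i
    proof -
      have "q ^ Suc m * v i = q ^ m / \<nu> * (\<mu> * v i)" by (simp add: q_def)
      also have "\<dots> \<le> q ^ m / \<nu> * (\<Sum>j<n. A $$ (i, j) * v j)"
        by (rule mult_left_mono[OF sub[OF i]]) (use q \<nu> r0 in auto)
      also have "\<dots> = (\<Sum>j<n. A $$ (i, j) / \<nu> * (q ^ m * v j))"
        by (simp add: sum_distrib_left sum_divide_distrib algebra_simps)
      also have "\<dots> \<le> u' i"
        unfolding u'_def
        by (intro sum_mono mult_left_mono u(2)) (use i nonneg \<nu> r0 in auto)
      finally show ?thesis .
    qed
    ultimately show ?case by metis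
  qed
  have bound: "q ^ m * v k \<le> (\<Sum>j<n. b * v j)" for m
  proof -
    obtain u where u: "((B ^\<^sub>m m) *\<^sub>v x) $ k = complex_of_real (u k)" "u k \<ge> q ^ m * v k"
      using grow[of m] nz(1) by blast
    have Bm: "B ^\<^sub>m m \<in> carrier_mat n n" by (rule pow_carrier_mat[OF B])
    have "q ^ m * v k \<le> cmod (((B ^\<^sub>m m) *\<^sub>v x) $ k)" using u by simp
    also have "((B ^\<^sub>m m) *\<^sub>v x) $ k = (\<Sum>j<n. (B ^\<^sub>m m) $$ (k, j) * complex_of_real (v j))"
      using B nz(1) by (simp add: scalar_prod_def atLeast0LessThan x_def)
    also have "cmod \<dots> \<le> (\<Sum>j<n. b * v j)"
    proof (rule sum_norm_le)
      fix j assume "j \<in> {..<n}"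
      then show "cmod ((B ^\<^sub>m m) $$ (k, j) * complex_of_real (v j)) \<le> b * v j"
        using b[of m] B nz(1) v0[of j]
        by (auto simp: norm_mult norm_bound_def intro!: mult_right_mono)
    qed
    finally show ?thesis .
  qed
  obtain m where "q ^ m > (\<Sum>j<n. b * v j) / v k" using real_arch_pow[OF q] by blast
  then show False using bound[of m] nz(2) by (simp add: field_simps)
qed

text \<open>Take the entrywise moduli of a complex eigenvector for \<open>r\<close>. As the matrix
  entries are non-negative, the triangle inequality turns the eigenvalue equation into the asserted
  inequality.\<close>

lemma abs_eigenvector:
  fixes A :: "int mat"
  assumes A: "A \<in> carrier_mat n n" and nonneg: "\<And>i j. i < n \<Longrightarrow> j < n \<Longrightarrow> A $$ (i, j) \<ge> 0"
    and pf: "perron_frobenius_eigenvalue A r"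
  obtains v :: "nat \<Rightarrow> real" where "\<And>i. v i \<ge> 0" "\<exists>i<n. v i > 0"
    "\<And>i. i < n \<Longrightarrow> r * v i \<le> (\<Sum>j<n. A $$ (i, j) * v j)"
proof -
  have ev: "eigenvalue (map_mat complex_of_int A) (complex_of_real r)"
    using pf by (simp add: perron_frobenius_eigenvalue_def)
  then obtain x where x: "x \<in> carrier_vec n" "x \<noteq> 0\<^sub>v n"
    "map_mat complex_of_int A *\<^sub>v x = complex_of_real r \<cdot>\<^sub>v x"
    using A unfolding eigenvalue_def eigenvector_def by auto
  show ?thesis
  proof
    show "cmod (x $ i) \<ge> 0" for i by simp
    show "\<exists>i<n. cmod (x $ i) > 0"
    proof (rule ccontr)
      assume "\<not> ?thesis"
      then have "x = 0\<^sub>v n" using x(1) by (intro eq_vecI) auto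
      then show False using x by simp
    qed
    fix i assume i: "i < n"
    have "complex_of_real r * x $ i = (map_mat complex_of_int A *\<^sub>v x) $ i"
      using x i by simp
    also have "\<dots> = (\<Sum>j<n. complex_of_int (A $$ (i, j)) * x $ j)"
      using A x(1) i by (simp add: scalar_prod_def atLeast0LessThan)
    finally have "cmod (complex_of_real r * x $ i) = cmod (\<Sum>j<n. complex_of_int (A $$ (i, j)) * x $ j)"
      by simp
    then have "r * cmod (x $ i) \<le> cmod (\<Sum>j<n. complex_of_int (A $$ (i, j)) * x $ j)"
      by (smt (verit) norm_mult norm_of_real mult_right_mono norm_ge_zero)
    also have "\<dots> \<le> (\<Sum>j<n. A $$ (i, j) * cmod (x $ j))"
      by (rule sum_norm_le) (use nonneg i in \<open>simp add: norm_mult\<close>)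
    finally show "r * cmod (x $ i) \<le> (\<Sum>j<n. A $$ (i, j) * cmod (x $ j))" .
  qed
qed

section \<open>Translation between adjacency matrices and sums over successors of darts\<close>

context
  fixes G :: "('s, 'e) pre_digraph" and M :: "int mat" and r :: real
    and D :: "'d set" and s :: "'d \<Rightarrow> 's" and nxt :: "'d \<Rightarrow> 'd set"
  assumes adj: "adjacency_matrix G M" and pf: "perron_frobenius_eigenvalue M r"
    and bij: "bij_betw s D (verts G)"
    and nxt: "\<And>d. d \<in> D \<Longrightarrow> nxt d \<subseteq> D"
    and arcs_card: "\<And>d d'. \<lbrakk>d \<in> D; d' \<in> D\<rbrakk> \<Longrightarrow>
       card {e \<in> arcs G. tail G e = s d \<and> head G e = s d'} = (if d' \<in> nxt d then 1 else 0)"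
begin

lemma enumeration:
  obtains n g where "bij_betw g {..<n} D" "M \<in> carrier_mat n n"
    "\<And>i j. i < n \<Longrightarrow> j < n \<Longrightarrow> M $$ (i, j) = (if g j \<in> nxt (g i) then 1 else 0)"
proof -
  obtain vs where vs: "distinct vs" "set vs = verts G"
    "M = mat (length vs) (length vs)
              (\<lambda>(i, j). int (card {e \<in> arcs G. tail G e = vs ! i \<and> head G e = vs ! j}))"
    using adj unfolding adjacency_matrix_def by blast
  define g where "g = the_inv_into D s \<circ> (!) vs"
  have "bij_betw ((!) vs) {..<length vs} (verts G)"
    using vs by (intro bij_betw_nth) auto
  then have g: "bij_betw g {..<length vs} D"
    unfolding g_def using bij_betw_the_inv_into[OF bij] bij_betw_trans by blast
  have sg: "s (g i) = vs ! i" if "i < length vs" for i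
    unfolding g_def using nth_mem[OF that] vs(2) f_the_inv_into_f_bij_betw[OF bij, of "vs ! i"] by simp
  show ?thesis
  proof (rule that[OF g])
    fix i j assume "i < length vs" "j < length vs"
    then show "M $$ (i, j) = (if g j \<in> nxt (g i) then 1 else 0)"
      using arcs_card[of "g i" "g j"] g sg vs(3) by (auto simp: bij_betw_def)
  qed (simp add: vs(3))
qed

lemma sum_enumeration:
  fixes v :: "'d \<Rightarrow> real" and f :: "int \<Rightarrow> real"
  assumes "bij_betw g {..<n} D"
    "\<And>i j. i < n \<Longrightarrow> j < n \<Longrightarrow> M $$ (i, j) = (if g j \<in> nxt (g i) then 1 else 0)" "i < n"
  shows "(\<Sum>j<n. M $$ (i, j) * v (g j)) = sum v (nxt (g i))"
proof -
  have gi: "g i \<in> D" using assms by (auto simp: bij_betw_def)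
  have fin: "finite D" using assms(1) bij_betw_finite by blast
  have "(\<Sum>j<n. M $$ (i, j) * v (g j)) = (\<Sum>j<n. (\<lambda>d. if d \<in> nxt (g i) then v d else 0) (g j))"
    by (intro sum.cong refl) (use assms in auto)
  also have "\<dots> = (\<Sum>d\<in>D. if d \<in> nxt (g i) then v d else 0)"
    by (rule sum.reindex_bij_betw[OF assms(1)])
  also have "\<dots> = sum v (nxt (g i))"
    using fin nxt[OF gi] by (simp add: sum.inter_restrict[symmetric] Int_absorb1)
  finally show ?thesis .
qed

lemma perron_subinvariant:
  obtains v :: "'d \<Rightarrow> real" where "\<And>d. v d \<ge> 0" "\<exists>d\<in>D. v d > 0"
    "\<And>d. d \<in> D \<Longrightarrow> r * v d \<le> sum v (nxt d)"
proof -
  obtain n g where g: "bij_betw g {..<n} D" and M: "M \<in> carrier_mat n n"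
    and Mij: "\<And>i j. i < n \<Longrightarrow> j < n \<Longrightarrow> M $$ (i, j) = (if g j \<in> nxt (g i) then 1 else 0)"
    by (rule enumeration, rule that)
  have M0: "\<And>i j. i < n \<Longrightarrow> j < n \<Longrightarrow> M $$ (i, j) \<ge> 0" using Mij by simp
  obtain x :: "nat \<Rightarrow> real"
    where x: "\<And>i. x i \<ge> 0" "\<exists>i<n. x i > 0"
      "\<And>i. i < n \<Longrightarrow> r * x i \<le> (\<Sum>j<n. M $$ (i, j) * x j)"
    by (rule abs_eigenvector[OF M M0 pf], assumption, assumption, rule that)
  define v where "v = x \<circ> the_inv_into {..<n} g"
  have vg: "v (g i) = x i" if "i < n" for i
    using that g by (simp add: v_def the_inv_into_f_f bij_betw_def)
  have Dg: "D = g ` {..<n}" using g by (simp add: bij_betw_def)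
  show ?thesis
  proof
    show "v d \<ge> 0" for d using x by (simp add: v_def)
    show "\<exists>d\<in>D. v d > 0" using x(2) vg Dg by auto
    fix d assume "d \<in> D"
    then obtain i where i: "i < n" "d = g i" using Dg by auto
    have "(\<Sum>j<n. M $$ (i, j) * x j) = (\<Sum>j<n. M $$ (i, j) * v (g j))"
      by (intro sum.cong refl) (simp add: vg)
    then show "r * v d \<le> sum v (nxt d)"
      using x(3)[OF i(1)] sum_enumeration[OF g Mij i(1), of v] vg i by simp
  qed
qed

text \<open>This is the Collatz-Wielandt bound for an arbitrary index set \<open>D\<close> of the
  vertices. It will be applied with the darts of the old core that survive the collapse as indices
  for the states of the new automaton.\<close>

lemma perron_maximal:
  fixes v :: "'d \<Rightarrow> real"
  assumes v: "\<And>d. d \<in> D \<Longrightarrow> v d \<ge> 0" "\<exists>d\<in>D. v d > 0"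
    "\<And>d. d \<in> D \<Longrightarrow> \<mu> * v d \<le> sum v (nxt d)"
  shows "\<mu> \<le> r"
proof -
  obtain n g where g: "bij_betw g {..<n} D" and M: "M \<in> carrier_mat n n"
    and Mij: "\<And>i j. i < n \<Longrightarrow> j < n \<Longrightarrow> M $$ (i, j) = (if g j \<in> nxt (g i) then 1 else 0)"
    by (rule enumeration, rule that)
  have Dg: "D = g ` {..<n}" using g by (simp add: bij_betw_def)
  obtain k where k: "k < n" "v (g k) > 0" using v(2) Dg by auto
  show ?thesis
  proof (rule collatz_wielandt[OF M _ pf, of "v \<circ> g" k])
    fix i assume "i < n"
    then show "\<mu> * (v \<circ> g) i \<le> (\<Sum>j<n. M $$ (i, j) * (v \<circ> g) j)"
      using v(3)[of "g i"] sum_enumeration[OF g Mij, of i v] Dg by simp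
  qed (use k v Mij Dg in auto)
qed

end

section \<open>Collapsing a forest\<close>

text \<open>Traversing the arc \<open>e\<close> forwards or backwards gives the darts \<open>(e, True)\<close> and \<open>(e, False)\<close>.\<close>

definition flip_dart :: "'e \<times> bool \<Rightarrow> 'e \<times> bool" where
  "flip_dart d = (fst d, \<not> snd d)"

definition dart_tail :: "('v, 'e) pre_digraph \<Rightarrow> 'e \<times> bool \<Rightarrow> 'v" where
  "dart_tail G d = (if snd d then tail G (fst d) else head G (fst d))"

text \<open>Non-negativity is stated separately: one vector on all darts is used throughout, and
  restricting it to fewer darts changes only the domain of summation.\<close>

definition subinvariant :: "'d set \<Rightarrow> ('d \<Rightarrow> 'd set) \<Rightarrow> real \<Rightarrow> ('d \<Rightarrow> real) \<Rightarrow> bool" where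
  "subinvariant D nxt lam v \<longleftrightarrow>
     (\<forall>d\<in>D. lam * v d \<le> sum v (nxt d)) \<and> (\<exists>d\<in>D. v d > 0)"

abbreviation arcs_connected :: "('v, 'e) pre_digraph \<Rightarrow> 'e set \<Rightarrow> ('v \<times> 'v) set" where
  "arcs_connected G C \<equiv> (arc_to_ends G ` C \<union> (arc_to_ends G ` C)\<inverse>)\<^sup>*"

lemma flip_dart_simps [simp]: "flip_dart (e, b) = (e, \<not> b)"
  by (simp add: flip_dart_def)

text \<open>Each contraction lowers the number of vertices by at most one, so equality in the
  cardinality bound says that \<open>C\<close> is a forest. Equality for \<open>C\<close> implies
  equality for the subsets met in the induction and forbids loops on the way. The quotient map stays
  in the old vertex type, so that contractions can be iterated without changing types.\<close>

lemma forest_contraction: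
  fixes G :: "('v, 'e) pre_digraph" and v :: "'e \<times> bool \<Rightarrow> real"
  assumes wf: "wf_digraph G" and finV: "finite (verts G)"
    and G: "branching_dart_graph (arcs G \<times> UNIV) flip_dart (dart_tail G)"
    and lam: "lam \<ge> 1" and v0: "\<And>d. v d \<ge> 0"
    and sub: "subinvariant (arcs G \<times> UNIV) (nb_succ (arcs G \<times> UNIV) flip_dart (dart_tail G)) lam v"
    and C: "finite C" "C \<subseteq> arcs G"
  shows "\<exists>q :: 'v \<Rightarrow> 'v. (\<forall>x\<in>verts G. \<forall>y\<in>verts G. q x = q y \<longleftrightarrow> (x, y) \<in> arcs_connected G C) \<and>
     card (verts G) \<le> card (q ` verts G) + card C \<and>
     (card (verts G) = card (q ` verts G) + card C \<longrightarrow>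
        branching_dart_graph ((arcs G - C) \<times> UNIV) flip_dart (q \<circ> dart_tail G) \<and>
        subinvariant ((arcs G - C) \<times> UNIV)
          (nb_succ ((arcs G - C) \<times> UNIV) flip_dart (q \<circ> dart_tail G)) lam v \<and>
        (C \<noteq> {} \<and> lam > 1 \<longrightarrow> (\<exists>d\<in>(arcs G - C) \<times> UNIV. v d = 0 \<or>
           lam * v d < sum v (nb_succ ((arcs G - C) \<times> UNIV) flip_dart (q \<circ> dart_tail G) d))))"
    (is "\<exists>q. ?equiv C q \<and> ?le C q \<and> (?eq C q \<longrightarrow> ?br C q \<and> ?sub C q \<and> ?strict C q)")
  using C
proof (induction C)
  case empty
  have "(id :: 'v \<Rightarrow> 'v) \<circ> dart_tail G = dart_tail G" by simp
  then show ?case using G sub by (intro exI[of _ id]) simp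
next
  case (insert c C)
  let ?D = "(arcs G - C) \<times> (UNIV :: bool set)"
  obtain q where equiv: "?equiv C q" and le: "?le C q" and
    good: "?eq C q \<longrightarrow> ?br C q \<and> ?sub C q \<and> ?strict C q"
    using insert by auto
  define a b where "a = tail G c" and "b = head G c"
  have ab: "a \<in> verts G" "b \<in> verts G"
    using insert wf by (auto simp: a_def b_def wf_digraph.tail_in_verts wf_digraph.head_in_verts)
  \<comment> \<open>The component of the head of \<open>c\<close> is sent to the name of the
    component of its tail.\<close>
  define q' where "q' x = (if q x = q b then q a else q x)" for x
  have equiv': "?equiv (insert c C) q'"
  proof (intro ballI iffI)
    fix x y assume xy: "x \<in> verts G" "y \<in> verts G"
    have mono: "arcs_connected G C \<subseteq> arcs_connected G (insert c C)"
      by (intro rtrancl_mono) auto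
    have q_imp: "(x', y') \<in> arcs_connected G (insert c C)" if "q x' = q y'" "x' \<in> verts G" "y' \<in> verts G" for x' y'
      using equiv that mono by blast
    have ab': "(a, b) \<in> arcs_connected G (insert c C)" "(b, a) \<in> arcs_connected G (insert c C)"
      by (auto simp: a_def b_def arc_to_ends_def intro!: r_into_rtrancl)
    {
      assume "q' x = q' y"
      then consider "q x = q y" | "q x = q b" "q a = q y" | "q x = q a" "q b = q y"
        by (auto simp: q'_def split: if_splits)
      then show "(x, y) \<in> arcs_connected G (insert c C)"
        using q_imp xy ab ab' by cases (meson rtrancl_trans)+
    next
      assume "(x, y) \<in> arcs_connected G (insert c C)"
      then show "q' x = q' y"
      proof induction
        case (step y z)
        have "q' (tail G e) = q' (head G e)" if "e \<in> insert c C" for e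
        proof (cases "e = c")
          case False
          then have e: "e \<in> C" "tail G e \<in> verts G" "head G e \<in> verts G"
            using that insert wf by (auto simp: wf_digraph.tail_in_verts wf_digraph.head_in_verts)
          then have "(tail G e, head G e) \<in> arcs_connected G C"
            by (auto simp: arc_to_ends_def intro!: r_into_rtrancl)
          then have "q (tail G e) = q (head G e)" using equiv e by blast
          then show ?thesis by (simp add: q'_def)
        qed (auto simp: q'_def a_def b_def)
        then show ?case using step by (auto simp: arc_to_ends_def)
      qed simp
    }
  qed
  have "q ` verts G \<subseteq> insert (q b) (q' ` verts G)"
    by (auto simp: q'_def image_iff)
  then have "card (q ` verts G) \<le> card (insert (q b) (q' ` verts G))"
    using finV by (intro card_mono) auto
  also have "\<dots> \<le> Suc (card (q' ` verts G))"
    by (rule card_insert_le_m1) (use finV in auto)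
  finally have cardq: "card (q ` verts G) \<le> Suc (card (q' ` verts G))" .
  show ?case
  proof (intro exI[of _ q'] conjI impI)
    show "?equiv (insert c C) q'" by (rule equiv')
    show "?le (insert c C) q'" using le cardq insert by simp
  next
    assume eq: "?eq (insert c C) q'"
    \<comment> \<open>If both ends of \<open>c\<close> were already identified, this step would lose
      no vertex and the count would miss equality by one.\<close>
    have "q a \<noteq> q b"
    proof
      assume "q a = q b"
      then have "q' = q" by (auto simp: q'_def)
      then show False using eq le insert by simp
    qed
    have "?eq C q" using eq le cardq insert by simp
    then have br: "?br C q" and sb: "?sub C q" using good by auto
    interpret branching_dart_graph ?D flip_dart "q \<circ> dart_tail G" by (rule br)
    interpret edge_contraction ?D flip_dart "q \<circ> dart_tail G" "(c, True)" "q' \<circ> dart_tail G"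
    proof
      show "(q \<circ> dart_tail G) (c, True) \<noteq> (q \<circ> dart_tail G) (flip_dart (c, True))"
        using \<open>q a \<noteq> q b\<close> by (simp add: dart_tail_def a_def b_def)
    next
      fix e f
      show "((q' \<circ> dart_tail G) e = (q' \<circ> dart_tail G) f) =
         ((q \<circ> dart_tail G) e = (q \<circ> dart_tail G) f \<or>
          {(q \<circ> dart_tail G) e, (q \<circ> dart_tail G) f} =
          {(q \<circ> dart_tail G) (c, True), (q \<circ> dart_tail G) (flip_dart (c, True))})"
        by (auto simp: q'_def a_def b_def dart_tail_def doubleton_eq_iff split: if_splits)
    qed (use insert in auto)
    have D': "?D - {(c, True), flip_dart (c, True)} = (arcs G - insert c C) \<times> UNIV"
      by auto
    show "?br (insert c C) q'" using contracted_branching unfolding D' .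
    have sub': "lam * v d \<le> sum v (succ d)" if "d \<in> ?D" for d
      using sb that unfolding subinvariant_def by blast
    show "?sub (insert c C) q'"
      unfolding subinvariant_def
      using subinvariant_contraction[OF lam v0 sub'] nonzero_contraction[OF _ v0 sub'] sb lam
      unfolding D' subinvariant_def by auto
    \<comment> \<open>The gain is not carried along the induction; the edge contracted last produces
      it afresh.\<close>
    show "\<exists>d\<in>(arcs G - insert c C) \<times> UNIV. v d = 0 \<or>
           lam * v d < sum v (nb_succ ((arcs G - insert c C) \<times> UNIV) flip_dart (q' \<circ> dart_tail G) d)"
      if "insert c C \<noteq> {} \<and> lam > 1"
      using contraction_strict[OF _ v0 sub'] that unfolding D' by auto
  qed
qed

text \<open>The classes of the collapse are the fibres of \<open>q\<close> on the vertices, so the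
  values of \<open>q\<close> can stand for the collapsed vertices.\<close>

lemma card_quotient_connected_via:
  assumes equiv: "\<And>x y. \<lbrakk>x \<in> verts G; y \<in> verts G\<rbrakk> \<Longrightarrow> q x = q y \<longleftrightarrow> (x, y) \<in> arcs_connected G C"
  shows "card (verts G // connected_via G C) = card (q ` verts G)"
    and "\<lbrakk>x \<in> verts G; y \<in> verts G\<rbrakk> \<Longrightarrow>
       connected_via G C `` {x} = connected_via G C `` {y} \<longleftrightarrow> q x = q y"
proof -
  define g where "g z = {y \<in> verts G. q y = z}" for z
  have cls: "connected_via G C `` {x} = g (q x)" if "x \<in> verts G" for x
  proof -
    have "q y = q x \<longleftrightarrow> (x, y) \<in> arcs_connected G C" if "y \<in> verts G" for y
      using equiv[OF \<open>x \<in> verts G\<close> that] by metis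
    then show ?thesis using that unfolding connected_via_def g_def by blast
  qed
  have inj: "inj_on g (q ` verts G)" by (auto simp: inj_on_def g_def)
  have "verts G // connected_via G C = g ` q ` verts G"
    using cls by (auto simp: quotient_def image_iff)
  then show "card (verts G // connected_via G C) = card (q ` verts G)"
    using card_image[OF inj] by simp
  show "connected_via G C `` {x} = connected_via G C `` {y} \<longleftrightarrow> q x = q y"
    if "x \<in> verts G" "y \<in> verts G"
    using that cls inj by (metis imageI inj_on_eq_iff)
qed

section \<open>The core of a subgroup\<close>

interpretation free: group free_group
  by (rule group_free_group)

abbreviation word_inv :: "'x word \<Rightarrow> 'x word" where
  "word_inv w \<equiv> map inv_letter (rev w)"

lemma carrier_free_group [simp]: "w \<in> carrier free_group \<longleftrightarrow> reduced w"
  by (simp add: free_group_def)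

lemma one_free_group [simp]: "\<one>\<^bsub>free_group\<^esub> = []"
  by (simp add: free_group_def)

lemma inv_letter_eq_iff [simp]: "inv_letter y = inv_letter z \<longleftrightarrow> y = z"
  by (metis inv_letter_inv)

lemma inv_letter_neq [simp]: "inv_letter y \<noteq> y" "y \<noteq> inv_letter y"
  by (auto simp: inv_letter_def prod_eq_iff)

lemma reduced_append:
  "reduced (u @ v) \<longleftrightarrow> reduced u \<and> reduced v \<and> (u = [] \<or> v = [] \<or> hd v \<noteq> inv_letter (last u))"
  by (auto simp: reduced_def successively_append_iff)

lemma reduced_word_inv: "reduced w \<Longrightarrow> reduced (word_inv w)"
  by (induction w) (auto simp: reduced_append reduced_Cons last_map last_rev)

lemma mult_append: "reduced (u @ v) \<Longrightarrow> u \<otimes>\<^bsub>free_group\<^esub> v = u @ v"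
  by (simp add: free_group_def reduce_reduced)

lemma mult_append_cancel:
  "reduced u \<Longrightarrow> reduced (u @ v) \<Longrightarrow> word_inv u \<otimes>\<^bsub>free_group\<^esub> (u @ v) = v"
  by (metis foldr_push_inverse foldr_append mult_free_group reduce_def reduce_reduced reduced_append)

lemma inv_free_group: "reduced w \<Longrightarrow> inv\<^bsub>free_group\<^esub> w = word_inv w"
  using mult_append_cancel[of w "[]"]
  by (intro free.inv_equality) (auto simp: reduced_word_inv)

lemma word_inv_neq:
  assumes "reduced w" "w \<noteq> []"
  shows "word_inv w \<noteq> w"
proof
  assume "word_inv w = w"
  text \<open>A word that is its own inverse has a middle letter that is its own inverse, or two middle
    letters that cancel.\<close>
  have nth: "w ! (length w - Suc k) = inv_letter (w ! k)" if "k < length w" for k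
  proof -
    have "w ! k = word_inv w ! k" using \<open>word_inv w = w\<close> by simp
    also have "\<dots> = inv_letter (w ! (length w - Suc k))" using that by (simp add: rev_nth)
    finally show ?thesis by simp
  qed
  show False
  proof (cases "even (length w)")
    case True
    then obtain n where n: "length w = 2 * n" by blast
    with assms(2) obtain m where m: "n = Suc m" by (cases n) auto
    have "w ! Suc m = inv_letter (w ! m)" using nth[of m] n m by simp
    then show False
      using assms(1) n m unfolding reduced_def successively_conv_nth by auto
  next
    case False
    then obtain n where "length w = 2 * n + 1" using oddE by blast
    then show False using nth[of n] by (simp add: mult_2)
  qed
qed

text \<open>A coset and a letter determine the next coset, so a walk in the extended Schreier graph
  is determined by its origin and its label. \<open>trace\<close> recovers the walk, which lets
  words replace paths from here on.\<close>

fun trace :: "'x word set \<Rightarrow> 'x word \<Rightarrow> ('x word set, 'x letter) arc list" where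
  "trace c [] = []"
| "trace c (y # w) = (c, y, c #>\<^bsub>free_group\<^esub> [y]) # trace (c #>\<^bsub>free_group\<^esub> [y]) w"

lemma cas_unique: "pre_digraph.cas G u p v \<Longrightarrow> pre_digraph.cas G u p v' \<Longrightarrow> v = v'"
  by (induction p arbitrary: u) (auto simp: pre_digraph.cas.simps)

locale free_subgroup =
  fixes K :: "'x word set"
  assumes subgroup: "subgroup K free_group"
begin

abbreviation vertex :: "'x word \<Rightarrow> 'x word set" where
  "vertex a \<equiv> K #>\<^bsub>free_group\<^esub> a"

abbreviation ext_arcs where "ext_arcs \<equiv> arcs (extended_core K)"

lemma reduced_K: "w \<in> K \<Longrightarrow> reduced w"
  using subgroup.subset[OF subgroup] by (auto simp: free_group_def)

lemma K_carrier: "K \<subseteq> carrier free_group"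
  using subgroup.subset[OF subgroup] .

lemma word_inv_K: "w \<in> K \<Longrightarrow> word_inv w \<in> K"
  using subgroup.m_inv_closed[OF subgroup] inv_free_group reduced_K by metis

lemma vertex_Nil [simp]: "vertex [] = K"
  using free.coset_mult_one[OF K_carrier] by simp

lemma vertex_mult: "reduced a \<Longrightarrow> reduced b \<Longrightarrow> vertex a #>\<^bsub>free_group\<^esub> b = vertex (a \<otimes>\<^bsub>free_group\<^esub> b)"
  using free.coset_mult_assoc[OF K_carrier] by simp

lemma vertex_snoc: "reduced (a @ [y]) \<Longrightarrow> vertex a #>\<^bsub>free_group\<^esub> [y] = vertex (a @ [y])"
  using vertex_mult[of a "[y]"] mult_append[of a "[y]"] by (simp add: reduced_append)

lemma vertex_eq_iff:
  "reduced a \<Longrightarrow> reduced b \<Longrightarrow> vertex a = vertex b \<longleftrightarrow> a \<otimes>\<^bsub>free_group\<^esub> inv\<^bsub>free_group\<^esub> b \<in> K"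
  by (metis carrier_free_group free.coset_join1 free.coset_mult_inv2 free.inv_closed free.m_closed
      free.rcos_self free.coset_join2 K_carrier free.coset_mult_inv1 subgroup)

lemma vertex_eq_K_iff: "reduced a \<Longrightarrow> vertex a = K \<longleftrightarrow> a \<in> K"
  by (metis carrier_free_group free.coset_join1 free.coset_join2 subgroup)

lemma rcosets_iff: "c \<in> rcosets\<^bsub>free_group\<^esub> K \<longleftrightarrow> (\<exists>a. reduced a \<and> c = vertex a)"
  by (auto simp: RCOSETS_def)

lemma coset_step:
  assumes "c \<in> rcosets\<^bsub>free_group\<^esub> K"
  shows "c #>\<^bsub>free_group\<^esub> [y] \<in> rcosets\<^bsub>free_group\<^esub> K"
    and "c #>\<^bsub>free_group\<^esub> [y] #>\<^bsub>free_group\<^esub> [inv_letter y] = c"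
proof -
  obtain a where a: "reduced a" "c = vertex a" using assms rcosets_iff by blast
  have y: "reduced [z]" for z :: "'x letter" by (simp add: reduced_Cons)
  show "c #>\<^bsub>free_group\<^esub> [y] \<in> rcosets\<^bsub>free_group\<^esub> K"
    using a y vertex_mult rcosets_iff free.m_closed by (metis carrier_free_group)
  have "[y] \<otimes>\<^bsub>free_group\<^esub> [inv_letter y] = []"
    by (simp add: mult_free_group y)
  then have "a \<otimes>\<^bsub>free_group\<^esub> [y] \<otimes>\<^bsub>free_group\<^esub> [inv_letter y] = a"
    using a(1) y free.m_assoc[of a "[y]" "[inv_letter y]"] free.r_one[of a] by (simp del: free.r_one)
  then show "c #>\<^bsub>free_group\<^esub> [y] #>\<^bsub>free_group\<^esub> [inv_letter y] = c"
    using a y vertex_mult free.m_closed[of a "[y]"] by simp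
qed

text \<open>An arc read backwards is the arc of the inverse letter, because multiplying by a letter
  and then by its inverse returns to the same coset. Positive and negative letters can therefore be
  treated alike.\<close>

lemma ext_schreier_arcs:
  "arcs (extended (schreier_graph K)) = {(c, y, c #>\<^bsub>free_group\<^esub> [y]) | c y. c \<in> rcosets\<^bsub>free_group\<^esub> K}"
    (is "?L = ?R")
proof (intro equalityI subsetI)
  fix e assume "e \<in> ?L"
  then consider c x where "c \<in> rcosets\<^bsub>free_group\<^esub> K" "e = (c, (x, True), c #>\<^bsub>free_group\<^esub> [(x, True)])"
    | c x where "c \<in> rcosets\<^bsub>free_group\<^esub> K" "e = (c #>\<^bsub>free_group\<^esub> [(x, True)], (x, False), c)"
    by (auto simp: extended_def schreier_graph_def labelled_digraph_def positive_arc_def negative_arc_def)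
  then show "e \<in> ?R"
  proof cases
    case 2
    then show ?thesis using coset_step[OF 2(1), of "(x, True)"] by (auto simp: inv_letter_def)
  qed blast
next
  fix e assume "e \<in> ?R"
  then obtain c x b where e: "c \<in> rcosets\<^bsub>free_group\<^esub> K" "e = (c, (x, b), c #>\<^bsub>free_group\<^esub> [(x, b)])"
    by auto
  show "e \<in> ?L"
  proof (cases b)
    case True
    then have "e = positive_arc (c, x, c #>\<^bsub>free_group\<^esub> [(x, True)])" using e by (simp add: positive_arc_def)
    then show ?thesis using e by (auto simp: extended_def schreier_graph_def labelled_digraph_def)
  next
    case False
    let ?d = "c #>\<^bsub>free_group\<^esub> [(x, False)]"
    have "?d #>\<^bsub>free_group\<^esub> [(x, True)] = c" using coset_step(2)[OF e(1), of "(x, False)"] by (simp add: inv_letter_def)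
    then have "e = negative_arc (?d, x, ?d #>\<^bsub>free_group\<^esub> [(x, True)])"
      using e False by (simp add: negative_arc_def)
    then show ?thesis using coset_step(1)[OF e(1)]
      by (auto simp: extended_def schreier_graph_def labelled_digraph_def)
  qed
qed

lemma ext_schreier_simps:
  "verts (extended (schreier_graph K)) = rcosets\<^bsub>free_group\<^esub> K"
  "tail (extended (schreier_graph K)) = fst"
  "head (extended (schreier_graph K)) = (\<lambda>e. snd (snd e))"
  by (auto simp: extended_def schreier_graph_def labelled_digraph_def)

lemma awalk_trace:
  assumes "pre_digraph.awalk (extended (schreier_graph K)) c p d"
  shows "p = trace c (map (\<lambda>e. fst (snd e)) p)"
  using assms
proof (induction p arbitrary: c)
  case (Cons e p)
  then have e: "c \<in> rcosets\<^bsub>free_group\<^esub> K" "e \<in> arcs (extended (schreier_graph K))" "fst e = c"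
    "set p \<subseteq> arcs (extended (schreier_graph K))"
    "pre_digraph.cas (extended (schreier_graph K)) (snd (snd e)) p d"
    by (auto simp: pre_digraph.awalk_def pre_digraph.cas.simps ext_schreier_simps)
  obtain y where y: "e = (c, y, c #>\<^bsub>free_group\<^esub> [y])" using e ext_schreier_arcs by auto
  have "pre_digraph.awalk (extended (schreier_graph K)) (c #>\<^bsub>free_group\<^esub> [y]) p d"
    using e y coset_step by (auto simp: pre_digraph.awalk_def ext_schreier_simps)
  then show ?case using Cons.IH y by simp
qed simp

lemma trace_awalk:
  "\<lbrakk>reduced (a @ w)\<rbrakk> \<Longrightarrow>
    pre_digraph.awalk (extended (schreier_graph K)) (vertex a) (trace (vertex a) w) (vertex (a @ w))"
proof (induction w arbitrary: a)
  case Nil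
  then show ?case by (auto simp: pre_digraph.awalk_def pre_digraph.cas.simps ext_schreier_simps rcosets_iff)
next
  case (Cons y w)
  have r: "reduced a" "reduced (a @ [y])" using Cons.prems by (auto simp: reduced_append reduced_Cons)
  have step: "vertex a #>\<^bsub>free_group\<^esub> [y] = vertex (a @ [y])" using vertex_snoc r by blast
  have "pre_digraph.awalk (extended (schreier_graph K)) (vertex (a @ [y])) (trace (vertex (a @ [y])) w) (vertex (a @ y # w))"
    using Cons.IH[of "a @ [y]"] Cons.prems by simp
  moreover have "vertex a \<in> rcosets\<^bsub>free_group\<^esub> K" using r rcosets_iff by blast
  ultimately show ?case
    using step
    by (cases y) (auto simp: pre_digraph.awalk_def pre_digraph.cas.simps ext_schreier_simps ext_schreier_arcs)
qed

lemma trace_reduced: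
  "c \<in> rcosets\<^bsub>free_group\<^esub> K \<Longrightarrow>
    successively (\<lambda>e f. f \<noteq> inverse_arc e) (trace c w) \<longleftrightarrow> reduced w"
proof (induction w arbitrary: c)
  case (Cons y w)
  have "c #>\<^bsub>free_group\<^esub> [y] \<in> rcosets\<^bsub>free_group\<^esub> K" using coset_step Cons.prems by blast
  then have IH: "successively (\<lambda>e f. f \<noteq> inverse_arc e) (trace (c #>\<^bsub>free_group\<^esub> [y]) w) \<longleftrightarrow> reduced w"
    by (rule Cons.IH)
  show ?case
  proof (cases w)
    case (Cons z u)
    then show ?thesis using IH coset_step[OF Cons.prems, of y]
      by (auto simp: inverse_arc_def reduced_Cons)
  qed (simp add: reduced_Cons)
qed simp

text \<open>A path is reduced exactly if its label is, and a reduced word read from the root returns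
  to it exactly if it lies in \<open>K\<close>. The core thereby becomes a matter of prefixes of
  elements of \<open>K\<close>.\<close>

lemma reduced_closed_path_iff:
  "reduced_closed_path (schreier_graph K) K p \<longleftrightarrow> (\<exists>w\<in>K. p = trace K w)"
proof
  assume p: "reduced_closed_path (schreier_graph K) K p"
  define w where "w = map (\<lambda>e. fst (snd e)) p"
  have walk: "pre_digraph.awalk (extended (schreier_graph K)) K p K" using p by (simp add: reduced_closed_path_def)
  then have pw: "p = trace K w" using awalk_trace w_def by metis
  have root: "K \<in> rcosets\<^bsub>free_group\<^esub> K" using walk by (simp add: pre_digraph.awalk_def ext_schreier_simps)
  have w: "reduced w" using p trace_reduced[OF root, of w] pw by (simp add: reduced_closed_path_def)
  have "pre_digraph.awalk (extended (schreier_graph K)) K p (vertex w)"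
    using trace_awalk[of "[]" w] w pw by simp
  with walk have "vertex w = K"
    using cas_unique unfolding pre_digraph.awalk_def by metis
  then show "\<exists>w\<in>K. p = trace K w" using w pw vertex_eq_K_iff by blast
next
  assume "\<exists>w\<in>K. p = trace K w"
  then obtain w where w: "w \<in> K" "p = trace K w" by blast
  have "vertex w = K" using w reduced_K vertex_eq_K_iff by blast
  moreover have "K \<in> rcosets\<^bsub>free_group\<^esub> K" using rcosets_iff[of K] vertex_Nil reduced_Nil by metis
  ultimately show "reduced_closed_path (schreier_graph K) K p"
    using trace_awalk[of "[]" w] w reduced_K[of w] trace_reduced by (simp add: reduced_closed_path_def)
qed

lemma set_trace:
  "reduced (a @ w) \<Longrightarrow>
    set (trace (vertex a) w) = {(vertex (a @ u), y, vertex (a @ u @ [y])) | u y v. w = u @ y # v}"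
proof (induction w arbitrary: a)
  case (Cons y w)
  have r: "reduced (a @ [y])" using Cons.prems by (auto simp: reduced_append reduced_Cons)
  have IH: "set (trace (vertex (a @ [y])) w) =
     {(vertex (a @ y # u), z, vertex (a @ y # u @ [z])) | u z v. w = u @ z # v}"
    using Cons.IH[of "a @ [y]"] Cons.prems by simp
  show ?case
    unfolding trace.simps list.set vertex_snoc[OF r] IH
    by (auto simp: Cons_eq_append_conv) (metis append_Cons append_Nil append_Nil2)+
qed simp

lemma set_awalk_verts_trace:
  "reduced (a @ w) \<Longrightarrow>
    set (pre_digraph.awalk_verts (extended (schreier_graph K)) (vertex a) (trace (vertex a) w)) =
      {vertex (a @ u) | u v. w = u @ v}"
proof (induction w arbitrary: a)
  case Nil
  then show ?case by (simp add: pre_digraph.awalk_verts.simps)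
next
  case (Cons y w)
  have r: "reduced (a @ [y])" using Cons.prems by (auto simp: reduced_append reduced_Cons)
  have IH: "set (pre_digraph.awalk_verts (extended (schreier_graph K)) (vertex (a @ [y])) (trace (vertex (a @ [y])) w)) =
     {vertex (a @ y # u) | u v. w = u @ v}"
    using Cons.IH[of "a @ [y]"] Cons.prems by simp
  show ?case
    unfolding trace.simps pre_digraph.awalk_verts.simps vertex_snoc[OF r] ext_schreier_simps list.set
    by (auto simp: IH Cons_eq_append_conv) (metis append_Nil2)
qed

lemma verts_core: "verts (core K) = {vertex a | a b. a @ b \<in> K}"
proof -
  have "set (pre_digraph.awalk_verts (extended (schreier_graph K)) K (trace K w)) =
      {vertex u | u v. w = u @ v}" if "w \<in> K" for w
    using set_awalk_verts_trace[of "[]" w] reduced_K[OF that] by simp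
  then show ?thesis
    unfolding core_def Let_def reduced_closed_path_iff by (auto simp: labelled_digraph_def) blast+
qed

lemma set_trace_K:
  assumes "w \<in> K" shows "set (trace K w) = {(vertex u, y, vertex (u @ [y])) | u y v. w = u @ y # v}"
  using set_trace[of "[]" w] reduced_K[OF assms] by simp

lemma arcs_core: "e \<in> arcs (core K) \<longleftrightarrow>
  e \<in> arcs (schreier_graph K) \<and> (\<exists>w\<in>K. positive_arc e \<in> set (trace K w) \<or> negative_arc e \<in> set (trace K w))"
  unfolding core_def Let_def reduced_closed_path_iff by (auto simp: labelled_digraph_def)

lemma inverse_arc_trace:
  assumes "w \<in> K" "e \<in> set (trace K w)"
  shows "inverse_arc e \<in> set (trace K (word_inv w))"
proof -
  obtain u y v where w: "w = u @ y # v" "e = (vertex u, y, vertex (u @ [y]))"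
    using assms set_trace_K by auto
  have red: "reduced (u @ y # v)" using reduced_K assms w by blast
  \<comment> \<open>The quotient of \<open>a\<close> by the inverse of \<open>b\<close> is the
    product of \<open>a\<close> and \<open>b\<close>, which lies in \<open>K\<close>; reading
    \<open>b\<close> backwards from the root thus ends where \<open>a\<close> does.\<close>
  have vinv: "vertex (word_inv b) = vertex a" if "a @ b \<in> K" for a b
  proof -
    have r: "reduced (a @ b)" using that reduced_K by blast
    then have rab: "reduced a" "reduced b" by (auto simp: reduced_append)
    have "a \<otimes>\<^bsub>free_group\<^esub> inv\<^bsub>free_group\<^esub> (word_inv b) = a \<otimes>\<^bsub>free_group\<^esub> b"
      using inv_free_group[OF rab(2)] rab free.inv_inv[of b] by simp
    also have "\<dots> \<in> K" using mult_append r that by metis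
    finally show ?thesis using vertex_eq_iff[OF rab(1) reduced_word_inv[OF rab(2)]] by simp
  qed
  have "vertex (word_inv v) = vertex (u @ [y])" "vertex (word_inv v @ [inv_letter y]) = vertex u"
    using vinv[of "u @ [y]" v] vinv[of u "y # v"] assms w by auto
  moreover have "word_inv w = word_inv v @ inv_letter y # word_inv u" using w by simp
  then have "(vertex (word_inv v), inv_letter y, vertex (word_inv v @ [inv_letter y])) \<in> set (trace K (word_inv w))"
    unfolding set_trace_K[OF word_inv_K[OF assms(1)]] by blast
  ultimately show ?thesis using w by (simp add: inverse_arc_def)
qed

lemma inverse_positive_arc: "inverse_arc (positive_arc e) = negative_arc e"
  and inverse_negative_arc: "inverse_arc (negative_arc e) = positive_arc e"
  by (auto simp: inverse_arc_def positive_arc_def negative_arc_def inv_letter_def split: prod.splits)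

text \<open>An arc may enter the core because it is traversed in one direction only, while the
  extended core contains both directions. The inverse element of \<open>K\<close> supplies the other
  one.\<close>

lemma ext_arcs_trace: "e \<in> ext_arcs \<longleftrightarrow> (\<exists>w\<in>K. e \<in> set (trace K w))"
proof
  assume "e \<in> ext_arcs"
  then obtain f where f: "f \<in> arcs (core K)" "e = positive_arc f \<or> e = negative_arc f"
    by (auto simp: extended_def labelled_digraph_def)
  then obtain w where "w \<in> K" "positive_arc f \<in> set (trace K w) \<or> negative_arc f \<in> set (trace K w)"
    using arcs_core by blast
  then show "\<exists>w\<in>K. e \<in> set (trace K w)"
    using f word_inv_K inverse_arc_trace inverse_positive_arc inverse_negative_arc by metis
next
  assume "\<exists>w\<in>K. e \<in> set (trace K w)"
  then obtain w where w: "w \<in> K" "e \<in> set (trace K w)" by blast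
  then obtain u y v where u: "w = u @ y # v" "e = (vertex u, y, vertex (u @ [y]))"
    using set_trace_K by auto
  have "reduced (u @ [y])" using reduced_K[OF w(1)] u by (auto simp: reduced_append reduced_Cons)
  then have "vertex u \<in> rcosets\<^bsub>free_group\<^esub> K" "e = (vertex u, y, vertex u #>\<^bsub>free_group\<^esub> [y])"
    using vertex_snoc[of u y] rcosets_iff[of "vertex u"] u by (auto simp: reduced_append)
  then have "e \<in> arcs (extended (schreier_graph K))"
    unfolding ext_schreier_arcs by blast
  then obtain f where f: "f \<in> arcs (schreier_graph K)" "e = positive_arc f \<or> e = negative_arc f"
    by (auto simp: extended_def labelled_digraph_def)
  then have "f \<in> arcs (core K)" using w arcs_core by blast
  then show "e \<in> ext_arcs" using f by (auto simp: extended_def labelled_digraph_def)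
qed

lemma ext_arcs_iff:
  "(c, y, d) \<in> ext_arcs \<longleftrightarrow> (\<exists>a b. a @ y # b \<in> K \<and> c = vertex a \<and> d = vertex (a @ [y]))"
proof -
  have "(c, y, d) \<in> set (trace K w) \<longleftrightarrow> (\<exists>a b. w = a @ y # b \<and> c = vertex a \<and> d = vertex (a @ [y]))"
    if "w \<in> K" for w
    unfolding set_trace_K[OF that] by blast
  then show ?thesis unfolding ext_arcs_trace by blast
qed

lemma ext_arcs_step:
  assumes "(c, y, d) \<in> ext_arcs"
  shows "c \<in> rcosets\<^bsub>free_group\<^esub> K" "d = c #>\<^bsub>free_group\<^esub> [y]" "c = d #>\<^bsub>free_group\<^esub> [inv_letter y]"
    "c \<in> verts (core K)" "d \<in> verts (core K)" "(d, inv_letter y, c) \<in> ext_arcs"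
proof -
  obtain a b where a: "a @ y # b \<in> K" "c = vertex a" "d = vertex (a @ [y])" using assms ext_arcs_iff by auto
  have r: "reduced a" "reduced (a @ [y])" using reduced_K[OF a(1)] by (auto simp: reduced_append reduced_Cons)
  show c: "c \<in> rcosets\<^bsub>free_group\<^esub> K" using a r rcosets_iff by blast
  show d: "d = c #>\<^bsub>free_group\<^esub> [y]" using a r vertex_snoc by simp
  show "c = d #>\<^bsub>free_group\<^esub> [inv_letter y]" using coset_step(2)[OF c, of y] d by simp
  show "c \<in> verts (core K)" using a verts_core by blast
  have "(a @ [y]) @ b \<in> K" using a by simp
  then show "d \<in> verts (core K)" using a verts_core by blast
  show "(d, inv_letter y, c) \<in> ext_arcs"
    using assms inverse_arc_trace word_inv_K unfolding ext_arcs_trace inverse_arc_def by fastforce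
qed

end

section \<open>The darts of the core as states of the automaton\<close>

definition dart_letter :: "('v, 'x) arc \<times> bool \<Rightarrow> 'x letter" where
  "dart_letter d = (arc_label (fst d), snd d)"

context free_subgroup
begin

abbreviation darts where "darts \<equiv> arcs (core K) \<times> (UNIV :: bool set)"

abbreviation origin where "origin \<equiv> dart_tail (core K)"

definition dart_arc :: "('x word set, 'x) arc \<times> bool \<Rightarrow> ('x word set, 'x letter) arc" where
  "dart_arc d = (origin d, dart_letter d, origin (flip_dart d))"

lemma tail_core [simp]: "tail (core K) = fst"
  and head_core [simp]: "head (core K) = (\<lambda>e. snd (snd e))"
  by (auto simp: core_def labelled_digraph_def Let_def)

lemma dart_arc_eq: "dart_arc d = (if snd d then positive_arc (fst d) else negative_arc (fst d))"
  by (auto simp: dart_arc_def dart_tail_def dart_letter_def flip_dart_def arc_label_def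
      positive_arc_def negative_arc_def split: prod.splits)

lemma dart_arc_flip: "dart_arc (flip_dart d) = inverse_arc (dart_arc d)"
  by (simp add: dart_arc_eq flip_dart_def inverse_positive_arc inverse_negative_arc)

lemma bij_dart_arc: "bij_betw dart_arc darts ext_arcs"
proof (rule bij_betwI')
  show "dart_arc d \<in> ext_arcs" if "d \<in> darts" for d
    using that by (auto simp: dart_arc_eq extended_def labelled_digraph_def)
  show "\<exists>d\<in>darts. e = dart_arc d" if "e \<in> ext_arcs" for e
  proof -
    obtain f where "f \<in> arcs (core K)" "e = positive_arc f \<or> e = negative_arc f"
      using \<open>e \<in> ext_arcs\<close> by (auto simp: extended_def labelled_digraph_def)
    then have "e = dart_arc (f, True) \<or> e = dart_arc (f, False)" "(f, True) \<in> darts" "(f, False) \<in> darts"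
      by (auto simp: dart_arc_eq)
    then show ?thesis by blast
  qed
  show "dart_arc d = dart_arc d' \<longleftrightarrow> d = d'" for d d'
    by (cases d; cases d'; cases "fst d"; cases "fst d'")
      (auto simp: dart_arc_eq positive_arc_def negative_arc_def)
qed

lemma dart_arc_in: "d \<in> darts \<Longrightarrow> (origin d, dart_letter d, origin (flip_dart d)) \<in> ext_arcs"
  using bij_dart_arc by (auto simp: bij_betw_def dart_arc_def)

lemma ext_arc_dart:
  assumes "(c, y, d) \<in> ext_arcs"
  obtains \<delta> where "\<delta> \<in> darts" "origin \<delta> = c" "dart_letter \<delta> = y" "origin (flip_dart \<delta>) = d"
proof -
  have "(c, y, d) \<in> dart_arc ` darts" using assms bij_dart_arc by (simp add: bij_betw_def)
  then obtain \<delta> where "\<delta> \<in> darts" "(c, y, d) = dart_arc \<delta>" by blast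
  then show ?thesis by (intro that[of \<delta>]) (simp_all add: dart_arc_def)
qed

text \<open>The core is folded: multiplication by a letter is a bijection of cosets, so a letter and
  either end determine the dart.\<close>

lemma dart_eqI:
  assumes "d \<in> darts" "d' \<in> darts" "dart_letter d = dart_letter d'"
    and "origin d = origin d' \<or> origin (flip_dart d) = origin (flip_dart d')"
  shows "d = d'"
proof -
  have "dart_arc d = dart_arc d'"
    unfolding dart_arc_def
    using assms(3,4) ext_arcs_step(2,3)[OF dart_arc_in[OF assms(1)]]
      ext_arcs_step(2,3)[OF dart_arc_in[OF assms(2)]] by metis
  then show ?thesis using inj_onD[OF bij_betw_imp_inj_on[OF bij_dart_arc]] assms(1,2) by blast
qed

text \<open>A state records the current vertex and the letter read last, which is the same as
  remembering the dart just traversed.\<close>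

definition dart_state where "dart_state d = (origin (flip_dart d), dart_letter d)"

lemma verts_ext_core: "verts (extended_core K) = verts (core K)"
  by (simp add: extended_def labelled_digraph_def)

lemma states_B: "states (automaton_B K) = {(v, y). \<exists>u. (u, y, v) \<in> ext_arcs}"
  using ext_arcs_step(5) by (auto simp: automaton_B_def Let_def verts_ext_core)

lemma transitions_B:
  "((v, y), z, (w, z)) \<in> transitions (automaton_B K) \<longleftrightarrow>
    (v, y) \<in> states (automaton_B K) \<and> (v, z, w) \<in> ext_arcs \<and> z \<noteq> inv_letter y"
  unfolding automaton_B_def Let_def automaton.simps by blast

lemma bij_dart_state: "bij_betw dart_state darts (verts (transition_diagram (automaton_B K)))"
proof (rule bij_betwI')
  show "dart_state d = dart_state d' \<longleftrightarrow> d = d'" if "d \<in> darts" "d' \<in> darts" for d d'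
    unfolding dart_state_def using dart_eqI[OF that] by blast
  show "dart_state d \<in> verts (transition_diagram (automaton_B K))" if "d \<in> darts" for d
    using dart_arc_in[OF that]
    by (auto simp: transition_diagram_def labelled_digraph_def states_B dart_state_def)
  show "\<exists>d\<in>darts. s = dart_state d" if s: "s \<in> verts (transition_diagram (automaton_B K))" for s
  proof -
    obtain u y v where "s = (v, y)" "(u, y, v) \<in> ext_arcs"
      using s by (auto simp: transition_diagram_def labelled_digraph_def states_B)
    then show ?thesis using ext_arc_dart by (metis dart_state_def)
  qed
qed

lemma dart_letter_flip: "dart_letter (flip_dart d) = inv_letter (dart_letter d)"
  by (simp add: dart_letter_def flip_dart_def inv_letter_def)

lemma flip_dart_darts: "d \<in> darts \<Longrightarrow> flip_dart d \<in> darts"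
  by (auto simp: flip_dart_def)

text \<open>At a common origin a letter names at most one dart, so avoiding the inverse dart and
  avoiding the inverse letter are the same condition.\<close>

lemma nb_succ_iff:
  assumes "d \<in> darts" "d' \<in> darts"
  shows "d' \<in> nb_succ darts flip_dart origin d \<longleftrightarrow>
    origin d' = origin (flip_dart d) \<and> dart_letter d' \<noteq> inv_letter (dart_letter d)"
  unfolding nb_succ_def mem_Collect_eq dart_letter_flip[symmetric]
  using assms dart_eqI[OF assms(2) flip_dart_darts[OF assms(1)]] by blast

lemma card_transitions:
  assumes d: "d \<in> darts" "d' \<in> darts"
  defines "T \<equiv> transition_diagram (automaton_B K)"
  shows "card {e \<in> arcs T. tail T e = dart_state d \<and> head T e = dart_state d'} =
    (if d' \<in> nb_succ darts flip_dart origin d then 1 else 0)"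
proof -
  define a where "a = (dart_state d, dart_letter d', dart_state d')"
  have "{e \<in> arcs T. tail T e = dart_state d \<and> head T e = dart_state d'} \<subseteq> {a}"
    by (auto simp: T_def transition_diagram_def labelled_digraph_def automaton_B_def Let_def
        dart_state_def a_def)
  moreover have "a \<in> arcs T \<longleftrightarrow> d' \<in> nb_succ darts flip_dart origin d"
  proof -
    have st: "dart_state d \<in> states (automaton_B K)"
      using bij_dart_state d(1) by (auto simp: bij_betw_def transition_diagram_def labelled_digraph_def)
    have "a \<in> arcs T \<longleftrightarrow> (origin (flip_dart d), dart_letter d', origin (flip_dart d')) \<in> ext_arcs \<and>
        dart_letter d' \<noteq> inv_letter (dart_letter d)"
      using st transitions_B[of "origin (flip_dart d)" "dart_letter d" "dart_letter d'" "origin (flip_dart d')"]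
      by (simp add: T_def transition_diagram_def labelled_digraph_def dart_state_def a_def)
    also have "(origin (flip_dart d), dart_letter d', origin (flip_dart d')) \<in> ext_arcs \<longleftrightarrow>
       origin d' = origin (flip_dart d)"
      using dart_arc_in[OF d(2)] ext_arcs_step(3) by metis
    finally show ?thesis using nb_succ_iff[OF d] by simp
  qed
  moreover have "tail T a = dart_state d" "head T a = dart_state d'"
    by (auto simp: T_def transition_diagram_def labelled_digraph_def a_def)
  ultimately have "{e \<in> arcs T. tail T e = dart_state d \<and> head T e = dart_state d'} =
      (if d' \<in> nb_succ darts flip_dart origin d then {a} else {})"
    by auto
  then show ?thesis by simp
qed

lemma wf_core: "wf_digraph (core K)"
proof
  fix e assume "e \<in> arcs (core K)"
  then have "(e, True) \<in> darts" by simp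
  from ext_arcs_step(4,5)[OF dart_arc_in[OF this]]
  show "tail (core K) e \<in> verts (core K)" "head (core K) e \<in> verts (core K)"
    by (simp_all add: dart_tail_def)
qed

lemma finite_arcs_core:
  assumes "finite (verts (core K))" "finite (UNIV :: 'x set)"
  shows "finite (arcs (core K))"
proof (rule finite_subset)
  show "arcs (core K) \<subseteq> verts (core K) \<times> UNIV \<times> verts (core K)"
    using wf_digraph.tail_in_verts[OF wf_core] wf_digraph.head_in_verts[OF wf_core] by force
qed (use assms in simp)

section \<open>Connectedness of the core, absence of dead ends, and branching\<close>

lemma trace_connected:
  assumes S: "\<And>e. e \<in> S \<Longrightarrow> inverse_arc e \<in> S"
    "\<And>e f. e \<in> S \<Longrightarrow> f \<in> ext_arcs \<Longrightarrow> fst f = fst e \<Longrightarrow> f \<in> S"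
    and "set (trace c w) \<subseteq> ext_arcs" "set (trace c w) \<inter> S \<noteq> {}"
  shows "set (trace c w) \<subseteq> S"
  using assms(3,4)
proof (induction w arbitrary: c)
  case (Cons y w)
  let ?d = "c #>\<^bsub>free_group\<^esub> [y]"
  show ?case
  proof (cases w)
    case Nil
    then show ?thesis using Cons.prems by auto
  next
    case (Cons z w')
    define f where "f = (?d, z, ?d #>\<^bsub>free_group\<^esub> [z])"
    have f: "f \<in> set (trace ?d w)" using Cons by (simp add: f_def)
    have ext: "(c, y, ?d) \<in> ext_arcs" "f \<in> ext_arcs" using Cons.prems f by auto
    have inv: "inverse_arc (c, y, ?d) = (?d, inv_letter y, c)" "inverse_arc (?d, inv_letter y, c) = (c, y, ?d)"
      by (auto simp: inverse_arc_def)
    have ext': "(?d, inv_letter y, c) \<in> ext_arcs" using ext_arcs_step(6)[OF ext(1)] .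
    have iff: "(c, y, ?d) \<in> S \<longleftrightarrow> f \<in> S"
    proof
      assume "(c, y, ?d) \<in> S"
      from S(1)[OF this] show "f \<in> S" unfolding inv by (rule S(2)) (use ext in \<open>auto simp: f_def\<close>)
    next
      assume "f \<in> S"
      then have "(?d, inv_letter y, c) \<in> S" by (rule S(2)) (use ext' in \<open>auto simp: f_def\<close>)
      from S(1)[OF this] show "(c, y, ?d) \<in> S" unfolding inv .
    qed
    have "set (trace ?d w) \<inter> S \<noteq> {}" using Cons.prems(2) f iff by auto
    then have "set (trace ?d w) \<subseteq> S" using Cons.IH Cons.prems(1) by auto
    then show ?thesis using f iff by auto
  qed
qed simp

text \<open>Membership spreads along each trace, since the inverse of an arc starts where the next
  arc does. It passes between traces at the root, where all of them begin, and the traces of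
  elements of \<open>K\<close> cover the core.\<close>

lemma darts_connected:
  assumes S: "S \<subseteq> darts" "S \<noteq> {}" and fl: "\<And>e. e \<in> S \<Longrightarrow> flip_dart e \<in> S"
    and cl: "\<And>e f. \<lbrakk>e \<in> S; f \<in> darts; origin f = origin e\<rbrakk> \<Longrightarrow> f \<in> S"
  shows "S = darts"
proof -
  let ?S = "dart_arc ` S"
  have inj: "inj_on dart_arc darts" using bij_dart_arc by (simp add: bij_betw_def)
  have S1: "inverse_arc e \<in> ?S" if "e \<in> ?S" for e
    using that fl dart_arc_flip by (metis (no_types, lifting) image_iff)
  have S2: "f \<in> ?S" if "e \<in> ?S" "f \<in> ext_arcs" "fst f = fst e" for e f
  proof -
    obtain d d' where d: "d \<in> S" "e = dart_arc d" "d' \<in> darts" "f = dart_arc d'"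
      using \<open>e \<in> ?S\<close> \<open>f \<in> ext_arcs\<close> bij_betw_imp_surj_on[OF bij_dart_arc] by blast
    then have "d' \<in> S" using cl[of d d'] \<open>fst f = fst e\<close> by (auto simp: dart_arc_def)
    then show ?thesis using d by blast
  qed
  have ext: "set (trace K w) \<subseteq> ext_arcs" if "w \<in> K" for w
    using that ext_arcs_trace by blast
  have "?S \<subseteq> ext_arcs" using S(1) bij_betw_imp_surj_on[OF bij_dart_arc] by blast
  then obtain e0 w0 where w0: "w0 \<in> K" "e0 \<in> set (trace K w0)" "e0 \<in> ?S"
    using S(2) ext_arcs_trace by blast
  have spread: "set (trace K w) \<subseteq> ?S" if "w \<in> K" "set (trace K w) \<inter> ?S \<noteq> {}" for w
    using trace_connected[of ?S K w, OF _ _ ext[OF that(1)] that(2)] S1 S2 by blast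
  have all0: "set (trace K w0) \<subseteq> ?S"
    by (rule spread) (use w0 in auto)
  have "e \<in> ?S" if e: "e \<in> ext_arcs" for e
  proof -
    obtain w where w: "w \<in> K" "e \<in> set (trace K w)" using e ext_arcs_trace by blast
    obtain y0 v0 y v where yv: "w0 = y0 # v0" "w = y # v" using w0(2) w(2) by (cases w0; cases w) auto
    have "hd (trace K w0) \<in> ?S" "hd (trace K w) \<in> ext_arcs" "fst (hd (trace K w)) = fst (hd (trace K w0))"
      using all0 ext[OF w(1)] yv by auto
    then have "hd (trace K w) \<in> ?S" using S2 by blast
    then have "set (trace K w) \<inter> ?S \<noteq> {}" using yv by (auto)
    then show ?thesis using spread w by blast
  qed
  then have "dart_arc ` darts \<subseteq> dart_arc ` S" using bij_betw_imp_surj_on[OF bij_dart_arc] by blast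
  then have "dart_arc ` S = dart_arc ` darts" using S(1) by blast
  then show ?thesis using inj_on_image_eq_iff[OF inj S(1) subset_refl] by blast
qed

text \<open>Inside an element of \<open>K\<close> the next letter continues the walk, so only the
  root could be a dead end. There the cyclically reduced \<open>w\<close> offers two different ways
  out, its first letter and the inverse of its last, and at most one of them backtracks.\<close>

lemma darts_succ_nonempty:
  assumes w: "w \<in> K" "w \<noteq> []" "cyclically_reduced w" and d: "d \<in> darts"
  shows "nb_succ darts flip_dart origin d \<noteq> {}"
proof -
  obtain a b where ab: "a @ dart_letter d # b \<in> K" "origin (flip_dart d) = vertex (a @ [dart_letter d])"
    using dart_arc_in[OF d, unfolded ext_arcs_iff] by blast
  have "\<exists>z e. (origin (flip_dart d), z, e) \<in> ext_arcs \<and> z \<noteq> inv_letter (dart_letter d)"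
  proof (cases b)
    case (Cons z b')
    have "(a @ [dart_letter d]) @ z # b' \<in> K" using ab Cons by simp
    then have "(origin (flip_dart d), z, vertex ((a @ [dart_letter d]) @ [z])) \<in> ext_arcs"
      using ab(2) ext_arcs_iff by metis
    moreover have "z \<noteq> inv_letter (dart_letter d)"
      using reduced_K[OF ab(1)] Cons by (auto simp: reduced_append reduced_Cons)
    ultimately show ?thesis by blast
  next
    case Nil
    have root: "origin (flip_dart d) = K"
      using ab Nil reduced_K vertex_eq_K_iff by (metis)
    have hd_ext: "(K, hd h, vertex [hd h]) \<in> ext_arcs" if "h \<in> K" "h \<noteq> []" for h
      using ext_arcs_iff[of K "hd h" "vertex [hd h]"] that
      by (metis append_Nil list.collapse vertex_Nil)
    have "inv_letter (last w) \<noteq> hd w"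
      using w by (metis cyclically_reduced_def inv_letter_inv)
    moreover have "hd (word_inv w) = inv_letter (last w)" using w(2) by (simp add: hd_map hd_rev)
    ultimately show ?thesis
      using hd_ext[OF w(1,2)] hd_ext[OF word_inv_K[OF w(1)]] w(2) root
      by (metis map_is_Nil_conv rev_is_Nil_conv)
  qed
  then obtain z e where z: "(origin (flip_dart d), z, e) \<in> ext_arcs" "z \<noteq> inv_letter (dart_letter d)" by blast
  obtain d' where "d' \<in> darts" "origin d' = origin (flip_dart d)" "dart_letter d' = z"
    by (rule ext_arc_dart[OF z(1)])
  then show ?thesis using nb_succ_iff[OF d] z by blast
qed

lemma cyclic_if_generated:
  assumes "u \<in> K" "K \<subseteq> generate free_group {u}"
  shows "cyclic_group (free_group\<lparr>carrier := K\<rparr>)"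
proof -
  have "generate free_group {u} \<subseteq> K"
    using assms(1) subgroup by (simp add: free.generate_subgroup_incl)
  then have "generate (free_group\<lparr>carrier := K\<rparr>) {u} = K"
    using assms subgroup free.generate_consistent[of "{u}" K] by auto
  then show ?thesis
    unfolding cyclic_group_def subgroup_generated_def using assms(1)
    by (intro bexI[of _ u]) auto
qed

text \<open>With at most two darts at each vertex, a reduced walk has no choice after its first
  letter. Two elements of \<open>K\<close> with the same first letter are then comparable as
  prefixes, and a shortest non-trivial element \<open>u\<close> generates \<open>K\<close> by
  repeated cancellation.\<close>

lemma darts_branch:
  assumes nc: "\<not> cyclic_group (free_group\<lparr>carrier := K\<rparr>)"
  shows "\<exists>f1\<in>darts. \<exists>f2\<in>darts. \<exists>f3\<in>darts. f1 \<noteq> f2 \<and> f1 \<noteq> f3 \<and> f2 \<noteq> f3 \<and>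
    origin f1 = origin f2 \<and> origin f1 = origin f3"
proof (rule ccontr)
  assume neg: "\<not> ?thesis"
  have deg2: False if "(v, x, a) \<in> ext_arcs" "(v, y, b) \<in> ext_arcs" "(v, z, c) \<in> ext_arcs"
    "x \<noteq> y" "x \<noteq> z" "y \<noteq> z" for v x y z a b c
    using neg that(4-) by (metis ext_arc_dart[OF that(1)] ext_arc_dart[OF that(2)] ext_arc_dart[OF that(3)])
  have ext: "(vertex a, y, vertex (a @ [y])) \<in> ext_arcs" if "a @ y # b \<in> K" for a y b
    using that ext_arcs_iff by blast
  \<comment> \<open>Two different continuations after \<open>x\<close>, together with the way back
    along the inverse of \<open>x\<close>, would be three darts at one vertex.\<close>
  have next_unique: "y = z" if "a @ x # y # b \<in> K" "a @ x # z # b' \<in> K" for a x y z b b'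
  proof (rule ccontr)
    assume "y \<noteq> z"
    have "(vertex (a @ [x]), inv_letter x, vertex a) \<in> ext_arcs"
      using ext_arcs_step(6)[OF ext[OF that(1)]] .
    moreover have "(vertex (a @ [x]), y, vertex (a @ [x, y])) \<in> ext_arcs"
      using ext[of "a @ [x]" y b] that by simp
    moreover have "(vertex (a @ [x]), z, vertex (a @ [x, z])) \<in> ext_arcs"
      using ext[of "a @ [x]" z b'] that by simp
    moreover have "inv_letter x \<noteq> y" "inv_letter x \<noteq> z"
      using reduced_K[OF that(1)] reduced_K[OF that(2)] by (auto simp: reduced_append reduced_Cons)
    ultimately show False using deg2 \<open>y \<noteq> z\<close> by blast
  qed
  have comparable: "(\<exists>r. q = p @ r) \<or> (\<exists>r. p = q @ r)" if "a @ x # p \<in> K" "a @ x # q \<in> K" for a x p q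
    using that
  proof (induction p arbitrary: a x q)
    case (Cons y p)
    show ?case
    proof (cases q)
      case (Cons z q')
      have "y = z" using next_unique[of a x y p z q'] Cons.prems Cons by simp
      then show ?thesis using Cons.IH[of "a @ [x]" y q'] Cons.prems Cons by auto
    qed simp
  qed simp
  have same_hd: "(\<exists>r. q = p @ r)" if pq: "p \<in> K" "q \<in> K" "p \<noteq> []" "q \<noteq> []" "hd p = hd q" "length p \<le> length q" for p q
  proof -
    obtain x p' q' where "p = x # p'" "q = x # q'" using pq(3-5) by (cases p; cases q) auto
    then show ?thesis using comparable[of "[]" x p' q'] pq by auto
  qed
  \<comment> \<open>An element and its inverse have the same length, so a common first letter would
    make them equal.\<close>
  have not_inv: "hd (word_inv p) \<noteq> hd p" if p: "p \<in> K" "p \<noteq> []" for p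
  proof
    assume "hd (word_inv p) = hd p"
    then obtain r where "word_inv p = p @ r" using same_hd[OF p(1) word_inv_K[OF p(1)] p(2)] p by auto
    moreover have "length (word_inv p) = length p" by simp
    ultimately have "word_inv p = p" by (metis append_Nil2 append_eq_append_conv)
    then show False using word_inv_neq reduced_K p by blast
  qed
  have root: "(K, hd p, vertex [hd p]) \<in> ext_arcs" if "p \<in> K" "p \<noteq> []" for p
    using ext[of "[]" "hd p" "tl p"] that by simp
  obtain u where u: "u \<in> K" "u \<noteq> []" "\<And>p. p \<in> K \<Longrightarrow> p \<noteq> [] \<Longrightarrow> length u \<le> length p"
  proof -
    have "\<exists>p. p \<in> K \<and> p \<noteq> []"
    proof (rule ccontr)
      assume "\<not> ?thesis"
      then have "K \<subseteq> {[]}" by blast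
      moreover have "[] \<in> K" using subgroup.one_closed[OF subgroup] by simp
      moreover have "[] \<in> generate free_group {[]}" using generate.one[of free_group] by simp
      ultimately have "cyclic_group (free_group\<lparr>carrier := K\<rparr>)"
        by (intro cyclic_if_generated[of "[]"]) auto
      then show False using nc by blast
    qed
    then show thesis using that arg_min_nat_lemma[of "\<lambda>p. p \<in> K \<and> p \<noteq> []" _ length] by blast
  qed
  \<comment> \<open>The first letters of \<open>u\<close> and of its inverse are distinct and
    already exhaust the darts at the root.\<close>
  have hds: "hd p = hd u \<or> hd p = hd (word_inv u)" if "p \<in> K" "p \<noteq> []" for p
    using deg2[OF root[OF that] root[OF u(1,2)] root[OF word_inv_K[OF u(1)]]] not_inv[OF u(1,2)] u(2) by force
  have gen: "p \<in> generate free_group {u}" if "p \<in> K" "p = [] \<or> hd p = hd u" for p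
    using that
  proof (induction "length p" arbitrary: p rule: less_induct)
    case less
    show ?case
    proof (cases "p = []")
      case True
      then show ?thesis using generate.one[of free_group "{u}"] by simp
    next
      case False
      then obtain r where r: "p = u @ r" using same_hd[OF u(1) less.prems(1) u(2) False] u(3) less.prems by auto
      have red: "reduced (u @ r)" "reduced u" using reduced_K less.prems u r by auto
      have "word_inv u \<otimes>\<^bsub>free_group\<^esub> p = r" using mult_append_cancel red r by blast
      then have rK: "r \<in> K"
        using subgroup.m_closed[OF subgroup word_inv_K[OF u(1)] less.prems(1)] by simp
      \<comment> \<open>As \<open>u @ r\<close> is reduced, \<open>r\<close> cannot begin with the
        inverse of the last letter of \<open>u\<close>, so it again begins like \<open>u\<close> and
        the induction applies.\<close>
      have "hd r \<noteq> hd (word_inv u)" if "r \<noteq> []"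
        using red(1) that u(2) by (auto simp: reduced_append hd_map hd_rev)
      then have "r \<in> generate free_group {u}"
        using less.hyps[of r] rK hds r u(2) by auto
      then show ?thesis
        using generate.eng[OF generate.incl[of u "{u}"]] mult_append[OF red(1)] r by fastforce
    qed
  qed
  have "K \<subseteq> generate free_group {u}"
  proof
    fix p assume p: "p \<in> K"
    show "p \<in> generate free_group {u}"
    proof (cases "p = [] \<or> hd p = hd u")
      case False
      then have "hd (word_inv p) = hd u"
        using hds[OF p] hds[OF word_inv_K[OF p]] not_inv[OF p] by auto
      then have "word_inv p \<in> generate free_group {u}" using gen word_inv_K[OF p] by blast
      then have "inv\<^bsub>free_group\<^esub> (word_inv p) \<in> generate free_group {u}"
        using free.generate_m_inv_closed[of "{u}"] reduced_K u(1) by auto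
      then show ?thesis
        using inv_free_group[OF reduced_word_inv[OF reduced_K[OF p]]] by (simp add: rev_map comp_def)
    qed (use gen p in blast)
  qed
  then show False using cyclic_if_generated u(1) nc by blast
qed

lemma branching_core:
  assumes "finite (arcs (core K))" "w \<in> K" "w \<noteq> []" "cyclically_reduced w"
    and "\<not> cyclic_group (free_group\<lparr>carrier := K\<rparr>)"
  shows "branching_dart_graph darts flip_dart origin"
proof
  show "finite darts" using assms by simp
  show "nb_succ darts flip_dart origin d \<noteq> {}" if "d \<in> darts" for d
    by (rule darts_succ_nonempty[OF assms(2-4) that])
  show "flip_dart d \<in> darts" if "d \<in> darts" for d by (rule flip_dart_darts[OF that])
  show "flip_dart (flip_dart d) = d" "flip_dart d \<noteq> d" for d :: "('x word set, 'x) arc \<times> bool"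
    by (auto simp: flip_dart_def prod_eq_iff)
  show "S = darts" if "S \<subseteq> darts" "S \<noteq> {}" "\<And>e. e \<in> S \<Longrightarrow> flip_dart e \<in> S"
    "\<And>e f. \<lbrakk>e \<in> S; f \<in> darts; origin f = origin e\<rbrakk> \<Longrightarrow> f \<in> S" for S
    by (rule darts_connected[OF that])
qed (rule darts_branch[OF assms(5)])

end

section \<open>Characters of order two and the Euler characteristic\<close>

text \<open>A homomorphism from \<open>K\<close> to the group of order two is encoded by the set of elements that it
  does not map to the identity.\<close>

definition mod2_characters :: "'x word set \<Rightarrow> 'x word set set" where
  "mod2_characters K = {\<chi>. \<chi> \<subseteq> K \<and>
     (\<forall>g\<in>K. \<forall>h\<in>K. g \<otimes>\<^bsub>free_group\<^esub> h \<in> \<chi> \<longleftrightarrow> (g \<in> \<chi>) \<noteq> (h \<in> \<chi>))}"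

lemma card_mod2_characters_image:
  assumes \<phi>: "\<phi> \<in> iso free_group free_group" and K: "subgroup K free_group"
  shows "card (mod2_characters (\<phi> ` K)) = card (mod2_characters K)"
proof -
  have Kc: "K \<subseteq> carrier free_group" using subgroup.subset[OF K] .
  have inj: "inj_on \<phi> K"
    using \<phi> Kc by (auto simp: iso_def bij_betw_def intro: inj_on_subset)
  have hom: "\<phi> (g \<otimes>\<^bsub>free_group\<^esub> h) = \<phi> g \<otimes>\<^bsub>free_group\<^esub> \<phi> h" if "g \<in> K" "h \<in> K" for g h
    using \<phi> Kc that by (intro hom_mult[of \<phi> free_group free_group]) (auto simp: iso_def)
  have cl: "g \<otimes>\<^bsub>free_group\<^esub> h \<in> K" if "g \<in> K" "h \<in> K" for g h
    using subgroup.m_closed[OF K] that .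
  have mem: "\<phi> g \<in> \<phi> ` \<chi> \<longleftrightarrow> g \<in> \<chi>" if "g \<in> K" "\<chi> \<subseteq> K" for g \<chi>
    using inj that by (meson inj_on_image_mem_iff)
  have "mod2_characters (\<phi> ` K) = (`) \<phi> ` mod2_characters K"
  proof (intro equalityI subsetI)
    fix \<psi> assume \<psi>: "\<psi> \<in> mod2_characters (\<phi> ` K)"
    let ?\<chi> = "{g \<in> K. \<phi> g \<in> \<psi>}"
    have "?\<chi> \<in> mod2_characters K"
      using \<psi> cl by (auto simp: mod2_characters_def hom)
    moreover have "\<psi> = \<phi> ` ?\<chi>" using \<psi> by (auto simp: mod2_characters_def)
    ultimately show "\<psi> \<in> (`) \<phi> ` mod2_characters K" by blast
  next
    fix \<psi> assume "\<psi> \<in> (`) \<phi> ` mod2_characters K"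
    then obtain \<chi> where \<chi>: "\<chi> \<subseteq> K" "\<psi> = \<phi> ` \<chi>"
      "\<And>g h. g \<in> K \<Longrightarrow> h \<in> K \<Longrightarrow> g \<otimes>\<^bsub>free_group\<^esub> h \<in> \<chi> \<longleftrightarrow> (g \<in> \<chi>) \<noteq> (h \<in> \<chi>)"
      by (auto simp: mod2_characters_def)
    have "\<phi> g \<otimes>\<^bsub>free_group\<^esub> \<phi> h \<in> \<psi> \<longleftrightarrow> (\<phi> g \<in> \<psi>) \<noteq> (\<phi> h \<in> \<psi>)" if "g \<in> K" "h \<in> K" for g h
      using \<chi> mem[of _ \<chi>] that cl hom by metis
    then show "\<psi> \<in> mod2_characters (\<phi> ` K)" using \<chi> by (auto simp: mod2_characters_def)
  qed
  moreover have "inj_on ((`) \<phi>) (mod2_characters K)"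
    using inj by (auto simp: inj_on_def mod2_characters_def) (metis inj_on_image_eq_iff inj)+
  ultimately show ?thesis by (simp add: card_image)
qed

text \<open>A set \<open>X\<close> of arcs stands for a function from arcs to Z/2. This is its value
  on the arc traversed from \<open>c\<close> by \<open>y\<close>, in whichever direction.\<close>

definition crosses :: "('x word set, 'x) arc set \<Rightarrow> 'x word set \<Rightarrow> 'x letter \<Rightarrow> bool" where
  "crosses X c y \<longleftrightarrow> (let d = c #>\<^bsub>free_group\<^esub> [y]
     in (if snd y then (c, fst y, d) else (d, fst y, c)) \<in> X)"

text \<open>The sum of the Z/2-valued function along a walk; \<open>\<noteq>\<close> between truth
  values is addition in Z/2.\<close>

fun parity :: "('x word set, 'x) arc set \<Rightarrow> 'x word set \<Rightarrow> 'x word \<Rightarrow> bool" where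
  "parity X c [] \<longleftrightarrow> False"
| "parity X c (y # w) \<longleftrightarrow> crosses X c y \<noteq> parity X (c #>\<^bsub>free_group\<^esub> [y]) w"

abbreviation walk_end :: "'x word set \<Rightarrow> 'x word \<Rightarrow> 'x word set" where
  "walk_end \<equiv> foldl (\<lambda>c y. c #>\<^bsub>free_group\<^esub> [y])"

lemma parity_append: "parity X c (u @ v) \<longleftrightarrow> parity X c u \<noteq> parity X (walk_end c u) v"
  by (induction u arbitrary: c) auto

context free_subgroup
begin

lemma crosses_inv:
  "c \<in> rcosets\<^bsub>free_group\<^esub> K \<Longrightarrow> crosses X (c #>\<^bsub>free_group\<^esub> [y]) (inv_letter y) = crosses X c y"
  using coset_step(2)[of c y] by (auto simp: crosses_def Let_def) (auto simp: inv_letter_def)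

text \<open>Cancelling a letter against its inverse removes two crossings of the same arc. Parities
  are therefore invariant under free reduction, which makes them additive on group products.\<close>

lemma parity_push:
  "c \<in> rcosets\<^bsub>free_group\<^esub> K \<Longrightarrow>
    parity X c (push y w) \<longleftrightarrow> crosses X c y \<noteq> parity X (c #>\<^bsub>free_group\<^esub> [y]) w"
  by (cases w) (auto simp: crosses_inv coset_step)

lemma parity_foldr_push:
  "c \<in> rcosets\<^bsub>free_group\<^esub> K \<Longrightarrow>
    parity X c (foldr push u v) \<longleftrightarrow> parity X c u \<noteq> parity X (walk_end c u) v"
  by (induction u arbitrary: c) (auto simp: parity_push coset_step(1))

lemma walk_end_vertex: "reduced u \<Longrightarrow> walk_end K u = vertex u"
proof (induction u rule: rev_induct)
  case (snoc y u)
  then have "reduced u" by (simp add: reduced_append)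
  then show ?case using snoc vertex_snoc by simp
qed simp

lemma K_rcoset: "K \<in> rcosets\<^bsub>free_group\<^esub> K"
  using rcosets_iff[of K] vertex_Nil reduced_Nil by metis

lemma parity_mult:
  assumes "reduced u" "reduced v"
  shows "parity X K (u \<otimes>\<^bsub>free_group\<^esub> v) \<longleftrightarrow> parity X K u \<noteq> parity X (vertex u) v"
  using parity_foldr_push[OF K_rcoset] assms by (simp add: mult_free_group walk_end_vertex)

lemma parity_mult_K:
  assumes "h \<in> K" "reduced v"
  shows "parity X K (h \<otimes>\<^bsub>free_group\<^esub> v) \<longleftrightarrow> parity X K h \<noteq> parity X K v"
proof -
  have "reduced h" "vertex h = K" using assms(1) reduced_K vertex_eq_K_iff by blast+
  then show ?thesis using parity_mult[of h v] assms(2) by simp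
qed

lemma root_in_core: "K \<in> verts (core K)"
proof -
  have "[] @ [] \<in> K" using subgroup.one_closed[OF subgroup] by simp
  then show ?thesis unfolding verts_core using vertex_Nil by blast
qed

text \<open>A chosen path from the root that stays inside the core, being a prefix of an element of
  \<open>K\<close>. The chosen paths need not form a tree; the only normalisation is the empty path
  at the root.\<close>

definition representative :: "'x word set \<Rightarrow> 'x word" where
  "representative v = (if v = K then [] else SOME a. vertex a = v \<and> (\<exists>b. a @ b \<in> K))"

lemma representative:
  assumes "v \<in> verts (core K)"
  shows "vertex (representative v) = v" "\<exists>b. representative v @ b \<in> K" "reduced (representative v)"
proof -
  have "vertex (representative v) = v \<and> (\<exists>b. representative v @ b \<in> K)"
  proof (cases "v = K")
    case True
    then show ?thesis using subgroup.one_closed[OF subgroup] by (auto simp: representative_def)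
  next
    case False
    have "\<exists>a. vertex a = v \<and> (\<exists>b. a @ b \<in> K)" using assms unfolding verts_core by blast
    from someI_ex[OF this] False show ?thesis by (simp add: representative_def)
  qed
  then show "vertex (representative v) = v" "\<exists>b. representative v @ b \<in> K" "reduced (representative v)"
    using reduced_K reduced_append by metis+
qed

lemma representative_K [simp]: "representative K = []"
  by (simp add: representative_def)

text \<open>Out along the chosen path to \<open>u\<close>, across the arc, and back along the chosen
  path from \<open>w\<close>: an element of \<open>K\<close> through which the value of a function
  on that arc can be recovered.\<close>

definition arc_loop :: "'x word set \<Rightarrow> 'x letter \<Rightarrow> 'x word set \<Rightarrow> 'x word" where
  "arc_loop u y w =
     representative u \<otimes>\<^bsub>free_group\<^esub> [y] \<otimes>\<^bsub>free_group\<^esub> inv\<^bsub>free_group\<^esub> (representative w)"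

lemma reduced_single [simp]: "reduced [y]"
  by (simp add: reduced_Cons)

lemma arc_loop_K:
  assumes "(u, y, w) \<in> ext_arcs"
  shows "arc_loop u y w \<in> K"
proof -
  note u = representative[OF ext_arcs_step(4)[OF assms]]
  note w = representative[OF ext_arcs_step(5)[OF assms]]
  have ry: "reduced (representative u \<otimes>\<^bsub>free_group\<^esub> [y])"
    using free.m_closed[of "representative u" "[y]"] u by simp
  have "vertex (representative u \<otimes>\<^bsub>free_group\<^esub> [y]) = vertex (representative w)"
    using vertex_mult[OF u(3), of "[y]"] u w ext_arcs_step(2)[OF assms] by simp
  then show ?thesis
    unfolding arc_loop_def using vertex_eq_iff[OF ry w(3)] by simp
qed

lemma parity_arc_loop:
  assumes "(u, y, w) \<in> ext_arcs"
  shows "crosses X u y \<longleftrightarrow> parity X K (representative u) \<noteq>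
    (parity X K (arc_loop u y w) \<noteq> parity X K (representative w))"
proof -
  note u = representative[OF ext_arcs_step(4)[OF assms]]
  note w = representative[OF ext_arcs_step(5)[OF assms]]
  have c: "representative u \<in> carrier free_group" "representative w \<in> carrier free_group" "[y] \<in> carrier free_group"
    using u w by simp_all
  have "arc_loop u y w \<otimes>\<^bsub>free_group\<^esub> representative w = representative u \<otimes>\<^bsub>free_group\<^esub> [y]"
    unfolding arc_loop_def using c by (simp add: free.m_assoc del: one_free_group carrier_free_group)
  then have "parity X K (representative u \<otimes>\<^bsub>free_group\<^esub> [y]) \<longleftrightarrow>
      parity X K (arc_loop u y w) \<noteq> parity X K (representative w)"
    using parity_mult_K[OF arc_loop_K[OF assms] w(3)] by metis
  then show ?thesis using parity_mult[OF u(3), of "[y]"] u(1) by auto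
qed

lemma inv_arc_loop:
  assumes "(u, y, w) \<in> ext_arcs"
  shows "inv\<^bsub>free_group\<^esub> (arc_loop u y w) = arc_loop w (inv_letter y) u"
proof -
  note u = representative[OF ext_arcs_step(4)[OF assms]]
  note w = representative[OF ext_arcs_step(5)[OF assms]]
  have c: "representative u \<in> carrier free_group" "representative w \<in> carrier free_group" "[y] \<in> carrier free_group"
    using u w by simp_all
  have y: "[inv_letter y] = inv\<^bsub>free_group\<^esub> [y]" by (simp add: inv_free_group)
  show ?thesis
    unfolding arc_loop_def y using c
    by (simp add: free.inv_mult_group free.m_assoc del: one_free_group carrier_free_group)
qed

text \<open>The root is left out of the second component because the value along its empty path is
  always zero.\<close>

definition arc_values :: "('x word set, 'x) arc set \<Rightarrow> 'x word set \<times> 'x word set set" where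
  "arc_values X = ({h \<in> K. parity X K h},
     {v \<in> verts (core K) - {K}. parity X K (representative v)})"

text \<open>This is the relation of \<open>parity_arc_loop\<close> solved for the arc: its value is
  the sum in Z/2 of the prescribed values at both ends and of the character on the loop through the
  arc.\<close>

definition values_arcs :: "'x word set \<times> 'x word set set \<Rightarrow> ('x word set, 'x) arc set" where
  "values_arcs = (\<lambda>(\<chi>, g). {(u, x, w) \<in> arcs (core K).
     (u \<in> g) \<noteq> ((arc_loop u (x, True) w \<in> \<chi>) \<noteq> (w \<in> g))})"

lemma ext_arcs_core:
  "(u, (x, True), w) \<in> ext_arcs \<longleftrightarrow> (u, x, w) \<in> arcs (core K)"
  "(u, (x, False), w) \<in> ext_arcs \<longleftrightarrow> (w, x, u) \<in> arcs (core K)"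
  by (force simp: extended_def labelled_digraph_def positive_arc_def negative_arc_def)+

lemma crosses_core:
  assumes "(u, y, w) \<in> ext_arcs"
  shows "crosses X u y \<longleftrightarrow> (if snd y then (u, fst y, w) else (w, fst y, u)) \<in> X"
  using ext_arcs_step(2)[OF assms] by (simp add: crosses_def)

lemma values_arcs_arc_values:
  assumes X: "X \<subseteq> arcs (core K)"
  shows "values_arcs (arc_values X) = X"
proof -
  have "(u, x, w) \<in> values_arcs (arc_values X) \<longleftrightarrow> (u, x, w) \<in> X" if e: "(u, x, w) \<in> arcs (core K)" for u x w
  proof -
    have e': "(u, (x, True), w) \<in> ext_arcs" using e ext_arcs_core by blast
    have "v \<in> snd (arc_values X) \<longleftrightarrow> parity X K (representative v)" if "v \<in> verts (core K)" for v
      using that by (auto simp: arc_values_def)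
    then show ?thesis
      using parity_arc_loop[OF e', of X] crosses_core[OF e', of X] e arc_loop_K[OF e']
        ext_arcs_step(4,5)[OF e']
      by (simp add: values_arcs_def arc_values_def)
  qed
  then have "e \<in> values_arcs (arc_values X) \<longleftrightarrow> e \<in> X" if "e \<in> arcs (core K)" for e
    using that by (cases e) simp
  moreover have "values_arcs (arc_values X) \<subseteq> arcs (core K)"
    by (auto simp: values_arcs_def split: prod.splits)
  ultimately show ?thesis using X by blast
qed

text \<open>Along a path in the core the values prescribed at the vertices telescope, which leaves
  the value at the end and the character on the loop that returns along the chosen path.\<close>

lemma arc_values_values_arcs:
  assumes \<chi>: "\<chi> \<in> mod2_characters K" and g: "g \<subseteq> verts (core K) - {K}"
  shows "arc_values (values_arcs (\<chi>, g)) = (\<chi>, g)"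
proof -
  let ?X = "values_arcs (\<chi>, g)"
  have mult: "p \<otimes>\<^bsub>free_group\<^esub> q \<in> \<chi> \<longleftrightarrow> (p \<in> \<chi>) \<noteq> (q \<in> \<chi>)" if "p \<in> K" "q \<in> K" for p q
    using \<chi> that by (auto simp: mod2_characters_def)
  have one: "[] \<in> K" "[] \<notin> \<chi>"
  proof -
    show "[] \<in> K" using subgroup.one_closed[OF subgroup] by simp
    then show "[] \<notin> \<chi>" using mult[of "[]" "[]"] by (simp add: mult_free_group)
  qed
  have inv: "inv\<^bsub>free_group\<^esub> p \<in> \<chi> \<longleftrightarrow> p \<in> \<chi>" if "p \<in> K" for p
    using mult[OF that subgroup.m_inv_closed[OF subgroup that]] one free.r_inv[of p] reduced_K[OF that]
    by auto
  have cr: "crosses ?X u y \<longleftrightarrow> (u \<in> g) \<noteq> ((arc_loop u y w \<in> \<chi>) \<noteq> (w \<in> g))"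
    if e: "(u, y, w) \<in> ext_arcs" for u y w
  proof (cases y)
    case (Pair x b)
    show ?thesis
    proof (cases b)
      case True
      then show ?thesis using crosses_core[OF e, of ?X] e ext_arcs_core Pair by (auto simp: values_arcs_def)
    next
      case False
      have "arc_loop w (x, True) u = inv\<^bsub>free_group\<^esub> (arc_loop u y w)"
        using inv_arc_loop[OF e] Pair False by (simp add: inv_letter_def)
      then have "arc_loop w (x, True) u \<in> \<chi> \<longleftrightarrow> arc_loop u y w \<in> \<chi>"
        using inv arc_loop_K[OF e] by simp
      then show ?thesis using crosses_core[OF e, of ?X] e ext_arcs_core Pair False by (auto simp: values_arcs_def)
    qed
  qed
  \<comment> \<open>Stated for prefixes so that induction along the path is possible. For an element
    of \<open>K\<close> it yields its character value, for a representative the value prescribed at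
    its vertex.\<close>
  have main: "parity ?X K a \<longleftrightarrow>
      (a \<otimes>\<^bsub>free_group\<^esub> inv\<^bsub>free_group\<^esub> (representative (vertex a)) \<in> \<chi>) \<noteq> (vertex a \<in> g)"
    if "a @ b \<in> K" for a b
    using that
  proof (induction a arbitrary: b rule: rev_induct)
    case Nil
    have "inv\<^bsub>free_group\<^esub> [] = ([] :: 'x word)" using free.inv_one by simp
    then show ?case using one g by (auto simp: mult_free_group)
  next
    case (snoc y a)
    let ?u = "vertex a" and ?w = "vertex (a @ [y])"
    have e: "(?u, y, ?w) \<in> ext_arcs" using snoc.prems ext_arcs_iff[of ?u y ?w] by auto
    note u = representative[OF ext_arcs_step(4)[OF e]]
    note w = representative[OF ext_arcs_step(5)[OF e]]
    have red: "reduced a" "reduced (a @ [y])"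
      using reduced_K[OF snoc.prems] by (auto simp: reduced_append reduced_Cons)
    have c: "a \<in> carrier free_group" "[y] \<in> carrier free_group"
      "representative ?u \<in> carrier free_group" "representative ?w \<in> carrier free_group"
      using red u w by simp_all
    define p where "p = a \<otimes>\<^bsub>free_group\<^esub> inv\<^bsub>free_group\<^esub> (representative ?u)"
    have pK: "p \<in> K"
      unfolding p_def using vertex_eq_iff[OF red(1) u(3)] u(1) by simp
    have cancel: "inv\<^bsub>free_group\<^esub> r \<otimes>\<^bsub>free_group\<^esub> (r \<otimes>\<^bsub>free_group\<^esub> s) = s"
      if "r \<in> carrier free_group" "s \<in> carrier free_group" for r s :: "'x word"
      using that free.inv_solve_left by (metis free.inv_closed free.m_closed)
    \<comment> \<open>The chosen path back from \<open>?u\<close> cancels against the chosen path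
      out to \<open>?u\<close>.\<close>
    have "p \<otimes>\<^bsub>free_group\<^esub> arc_loop ?u y ?w =
        (a \<otimes>\<^bsub>free_group\<^esub> [y]) \<otimes>\<^bsub>free_group\<^esub> inv\<^bsub>free_group\<^esub> (representative ?w)"
      unfolding p_def arc_loop_def using c cancel
      by (simp add: free.m_assoc del: one_free_group carrier_free_group)
    also have "a \<otimes>\<^bsub>free_group\<^esub> [y] = a @ [y]" using red mult_append by blast
    finally have "(a @ [y]) \<otimes>\<^bsub>free_group\<^esub> inv\<^bsub>free_group\<^esub> (representative ?w) \<in> \<chi> \<longleftrightarrow>
        (p \<in> \<chi>) \<noteq> (arc_loop ?u y ?w \<in> \<chi>)"
      using mult[OF pK arc_loop_K[OF e]] by simp
    moreover have "parity ?X K (a @ [y]) \<longleftrightarrow> parity ?X K a \<noteq> crosses ?X ?u y"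
      using parity_append[of ?X K a "[y]"] walk_end_vertex[OF red(1)] by simp
    moreover have "parity ?X K a \<longleftrightarrow> (p \<in> \<chi>) \<noteq> (?u \<in> g)"
      unfolding p_def using snoc.IH[of "y # b"] snoc.prems by simp
    ultimately show ?case using cr[OF e] by auto
  qed
  have "parity ?X K h \<longleftrightarrow> h \<in> \<chi>" if "h \<in> K" for h
  proof -
    have "inv\<^bsub>free_group\<^esub> [] = ([] :: 'x word)" using free.inv_one by simp
    moreover have "vertex h = K" using vertex_eq_K_iff reduced_K that by blast
    moreover have "h \<otimes>\<^bsub>free_group\<^esub> [] = h" using free.r_one[of h] reduced_K[OF that] by (simp del: free.r_one)
    ultimately show ?thesis using main[of h "[]"] that g by auto
  qed
  moreover have "parity ?X K (representative v) \<longleftrightarrow> v \<in> g" if "v \<in> verts (core K)" for v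
  proof -
    note v = representative[OF that]
    have "representative v \<otimes>\<^bsub>free_group\<^esub> inv\<^bsub>free_group\<^esub> (representative v) = []"
      using free.r_inv[of "representative v"] v by simp
    then show ?thesis using main v one by metis
  qed
  moreover have "\<chi> \<subseteq> K" using \<chi> by (simp add: mod2_characters_def)
  ultimately show ?thesis using g unfolding arc_values_def by auto
qed

lemma arc_values_character: "fst (arc_values X) \<in> mod2_characters K"
  using parity_mult_K reduced_K subgroup.m_closed[OF subgroup]
  by (auto simp: arc_values_def mod2_characters_def)

text \<open>Both sides count the maps from the arcs of the core to the group of order two: such a map
  is given by its sums along the loops at the root, together with its sums along a fixed path
  from the root to each other vertex.\<close>

lemma card_mod2_characters:
  assumes "finite (verts (core K))" "finite (arcs (core K))"
  shows "2 ^ card (arcs (core K)) = card (mod2_characters K) * 2 ^ (card (verts (core K)) - 1)"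
proof -
  have "bij_betw arc_values (Pow (arcs (core K))) (mod2_characters K \<times> Pow (verts (core K) - {K}))"
  proof (rule bij_betw_byWitness[where f' = values_arcs])
    show "\<forall>X\<in>Pow (arcs (core K)). values_arcs (arc_values X) = X" using values_arcs_arc_values by blast
    show "\<forall>p\<in>mod2_characters K \<times> Pow (verts (core K) - {K}). arc_values (values_arcs p) = p"
      using arc_values_values_arcs by auto
    show "arc_values ` Pow (arcs (core K)) \<subseteq> mod2_characters K \<times> Pow (verts (core K) - {K})"
    proof
      fix p assume "p \<in> arc_values ` Pow (arcs (core K))"
      then obtain X where "p = arc_values X" by blast
      then show "p \<in> mod2_characters K \<times> Pow (verts (core K) - {K})"
        using arc_values_character[of X] by (auto simp: mem_Times_iff arc_values_def)
    qed
    show "values_arcs ` (mod2_characters K \<times> Pow (verts (core K) - {K})) \<subseteq> Pow (arcs (core K))"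
      by (auto simp: values_arcs_def)
  qed
  from bij_betw_same_card[OF this] show ?thesis
    using assms root_in_core by (simp add: card_Pow card_cartesian_product card_Diff_singleton)
qed

end

section \<open>Comparison of the two automata across the collapse\<close>

lemma collapse_simps:
  "verts (collapse G C) = verts G // connected_via G C" "arcs (collapse G C) = arcs G - C"
  "tail (collapse G C) e = connected_via G C `` {tail G e}"
  "head (collapse G C) e = connected_via G C `` {head G e}"
  by (simp_all add: collapse_def)

lemma nb_succ_subset: "nb_succ D i t d \<subseteq> D"
  by (auto simp: nb_succ_def)

theorem theorem4:
  fixes H :: "'x::finite word set"
    and \<phi> :: "'x word \<Rightarrow> 'x word"
    and M M\<^sub>1 :: "int mat"
    and lam lam\<^sub>1 :: real
  assumes rank: "CARD('x) > 2"
    and H_generated: "\<exists>S. finite S \<and> (\<forall>w\<in>S. cyclically_reduced w) \<and> H = generate free_group S"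
    and H_non_cyclic: "\<not> cyclic_group (free_group\<lparr>carrier := H\<rparr>)"
    and H_free_factor: "free_factor free_group H"
    and more_than_one_vertex: "card (verts (core H)) > 1"
    and \<phi>_whitehead: "\<exists>A a. whitehead_automorphism A a \<phi>"
    and fewer_vertices: "card (verts (core (\<phi> ` H))) < card (verts (core H))"
    and fewer_edges: "card (arcs (core (\<phi> ` H))) < card (arcs (core H))"
    and collapsing: "obtained_by_collapsing (core H) (core (\<phi> ` H))"
    and adj_M: "adjacency_matrix (transition_diagram (automaton_B H)) M"
    and adj_M\<^sub>1: "adjacency_matrix (transition_diagram (automaton_B (\<phi> ` H))) M\<^sub>1"
    and PF_M: "perron_frobenius_eigenvalue M lam"
    and PF_M\<^sub>1: "perron_frobenius_eigenvalue M\<^sub>1 lam\<^sub>1"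
  shows "lam < lam\<^sub>1"
proof -
  obtain S where S: "\<And>w. w \<in> S \<Longrightarrow> cyclically_reduced w" "H = generate free_group S"
    using H_generated by blast
  have "S \<subseteq> carrier free_group" using S(1) by (auto simp: cyclically_reduced_def)
  then have subH: "subgroup H free_group" using S(2) free.generate_is_subgroup by blast
  have iso: "\<phi> \<in> iso free_group free_group"
    using \<phi>_whitehead by (auto simp: whitehead_automorphism_def)
  then have "group_hom free_group free_group \<phi>"
    by (simp add: group_hom_def group_hom_axioms_def iso_def group_free_group)
  then have subH1: "subgroup (\<phi> ` H) free_group"
    using group_hom.subgroup_img_is_subgroup subH by blast
  interpret h: free_subgroup H by (rule free_subgroup.intro[OF subH])
  interpret h1: free_subgroup "\<phi> ` H" by (rule free_subgroup.intro[OF subH1])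
  let ?G = "core H"
  let ?E = "arcs ?G" and ?V = "verts ?G"
  have finV: "finite ?V" using more_than_one_vertex card.infinite by fastforce
  have finE: "finite ?E" by (rule h.finite_arcs_core[OF finV]) simp
  obtain w where w: "w \<in> S" "w \<noteq> []"
  proof -
    have "\<exists>w. w \<in> S \<and> w \<noteq> []"
    proof (rule ccontr)
      assume "\<not> ?thesis"
      then have "S \<subseteq> {[]}" by blast
      then have "H \<subseteq> generate free_group {[]}" unfolding S(2) by (rule free.mono_generate)
      moreover have "[] \<in> H" using subgroup.one_closed[OF subH] by simp
      ultimately show False using h.cyclic_if_generated H_non_cyclic by blast
    qed
    then show thesis using that by blast
  qed
  have "w \<in> H" unfolding S(2) by (rule generate.incl[OF w(1)])
  then have br: "branching_dart_graph h.darts flip_dart h.origin"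
    using h.branching_core[OF finE _ w(2) S(1)[OF w(1)] H_non_cyclic] by blast
  interpret b: branching_dart_graph h.darts flip_dart h.origin by (rule br)
  obtain C f where C: "C \<subseteq> ?E" and iso_f: "pre_digraph.digraph_isomorphism (collapse ?G C) f"
    and core1: "core (\<phi> ` H) = app_iso f (collapse ?G C)"
    using collapsing unfolding obtained_by_collapsing_def by blast
  have finC: "finite C" using C finE finite_subset by blast
  have inj_verts: "inj_on (iso_verts f) (?V // connected_via ?G C)"
    and inj_arcs: "inj_on (iso_arcs f) (?E - C)"
    and tail_f: "\<And>e. e \<in> ?E - C \<Longrightarrow> iso_tail f (iso_arcs f e) = iso_verts f (connected_via ?G C `` {tail ?G e})"
    and head_f: "\<And>e. e \<in> ?E - C \<Longrightarrow> iso_head f (iso_arcs f e) = iso_verts f (connected_via ?G C `` {head ?G e})"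
    using iso_f unfolding pre_digraph.digraph_isomorphism_def collapse_simps by auto
  have V1: "verts (core (\<phi> ` H)) = iso_verts f ` (?V // connected_via ?G C)"
    and E1: "arcs (core (\<phi> ` H)) = iso_arcs f ` (?E - C)"
    unfolding core1 by (simp_all add: collapse_simps)
  have finV1: "finite (verts (core (\<phi> ` H)))" unfolding V1 quotient_def using finV by simp
  have finE1: "finite (arcs (core (\<phi> ` H)))" unfolding E1 using finE by simp
  have cardE1: "card (arcs (core (\<phi> ` H))) + card C = card ?E"
    unfolding E1 card_image[OF inj_arcs] using card_Diff_subset[OF finC C] card_mono[OF finE C] by simp
  have cardV1: "card (verts (core (\<phi> ` H))) = card (?V // connected_via ?G C)"
    unfolding V1 by (rule card_image[OF inj_verts])
  text \<open>The two subgroups are isomorphic, so their cores have the same Euler characteristic.\<close>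
  have euler: "card ?V = card (?V // connected_via ?G C) + card C"
  proof -
    let ?v1 = "card (verts (core (\<phi> ` H)))" and ?e1 = "card (arcs (core (\<phi> ` H)))"
    have a: "2 ^ card ?E = card (mod2_characters H) * 2 ^ (card ?V - 1)"
      by (rule h.card_mod2_characters[OF finV finE])
    have a1: "2 ^ ?e1 = card (mod2_characters H) * 2 ^ (?v1 - 1)"
      using h1.card_mod2_characters[OF finV1 finE1] card_mod2_characters_image[OF iso subH] by simp
    have "(2::nat) ^ (card ?E + (?v1 - 1)) = 2 ^ (?e1 + (card ?V - 1))"
      unfolding power_add a a1 by simp
    then have "card ?E + (?v1 - 1) = ?e1 + (card ?V - 1)" by simp
    \<comment> \<open>Both cores contain their root, so the truncated subtractions of 1 are
      genuine.\<close>
    moreover have "?v1 > 0" using h1.root_in_core finV1 by (auto simp: card_gt_0_iff)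
    ultimately show ?thesis using cardE1 cardV1 more_than_one_vertex by linarith
  qed
  \<comment> \<open>Contraction requires a factor of at least 1. If \<open>lam\<close> does not
    exceed 1, the constant vector with factor 1 takes over; it is subinvariant because every dart
    has a successor.\<close>
  obtain lam' v where lam': "lam' \<ge> 1" "lam \<le> lam'" and v0: "\<And>d. v d \<ge> 0"
    and sub: "subinvariant h.darts (nb_succ h.darts flip_dart h.origin) lam' v"
    and lam_v: "lam' > 1 \<or> (lam' = 1 \<and> v = (\<lambda>_. 1))"
  proof (cases "lam > 1")
    case True
    obtain v where "\<And>d. v d \<ge> 0" "\<exists>d\<in>h.darts. v d > 0"
      "\<And>d. d \<in> h.darts \<Longrightarrow> lam * v d \<le> sum v (nb_succ h.darts flip_dart h.origin d)"
      by (rule perron_subinvariant[OF adj_M PF_M h.bij_dart_state nb_succ_subset h.card_transitions],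
          assumption, assumption, rule that)
    then show thesis using True that[of lam v] by (auto simp: subinvariant_def)
  next
    case False
    have "1 \<le> card (b.succ d)" if "d \<in> h.darts" for d
      using b.succ_nonempty[OF that] b.finite_succ by (simp add: Suc_leI card_gt_0_iff)
    moreover have "h.darts \<noteq> {}" using b.branch_dart by blast
    ultimately have "subinvariant h.darts (nb_succ h.darts flip_dart h.origin) 1 (\<lambda>_. 1)"
      by (auto simp: subinvariant_def)
    then show thesis using False that[of 1 "\<lambda>_. 1"] by auto
  qed
  obtain q :: "'x word set \<Rightarrow> 'x word set"
    where q: "\<forall>x\<in>?V. \<forall>y\<in>?V. q x = q y \<longleftrightarrow> (x, y) \<in> arcs_connected ?G C"
    and good: "card ?V = card (q ` ?V) + card C \<longrightarrow>
        branching_dart_graph ((?E - C) \<times> UNIV) flip_dart (q \<circ> h.origin) \<and>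
        subinvariant ((?E - C) \<times> UNIV) (nb_succ ((?E - C) \<times> UNIV) flip_dart (q \<circ> h.origin)) lam' v \<and>
        (C \<noteq> {} \<and> lam' > 1 \<longrightarrow> (\<exists>d\<in>(?E - C) \<times> UNIV. v d = 0 \<or>
           lam' * v d < sum v (nb_succ ((?E - C) \<times> UNIV) flip_dart (q \<circ> h.origin) d)))"
    using forest_contraction[OF h.wf_core finV br lam'(1) v0 sub finC C] by blast
  have class_q: "card (?V // connected_via ?G C) = card (q ` ?V)"
    "\<And>x y. x \<in> ?V \<Longrightarrow> y \<in> ?V \<Longrightarrow> connected_via ?G C `` {x} = connected_via ?G C `` {y} \<longleftrightarrow> q x = q y"
    using card_quotient_connected_via[of ?G q C] q by blast+
  define D where "D = (?E - C) \<times> (UNIV :: bool set)"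
  define nxt where "nxt = nb_succ D flip_dart (q \<circ> h.origin)"
  have "card ?V = card (q ` ?V) + card C" using euler class_q(1) by simp
  with good have br1: "branching_dart_graph D flip_dart (q \<circ> h.origin)"
    and sub1: "subinvariant D nxt lam' v"
    and strict1: "C \<noteq> {} \<and> lam' > 1 \<longrightarrow> (\<exists>d\<in>D. v d = 0 \<or> lam' * v d < sum v (nxt d))"
    by (simp_all add: D_def nxt_def)
  interpret b1: branching_dart_graph D flip_dart "q \<circ> h.origin" by (rule br1)
  have sub1': "lam' * v d \<le> sum v (nxt d)" if "d \<in> D" for d
    using sub1 that unfolding subinvariant_def by blast
  \<comment> \<open>For \<open>lam' > 1\<close>, equality everywhere would make \<open>v\<close> an
    eigenvector, hence positive, which contradicts both alternatives left by the last contraction.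
    For the constant vector, a dart entering a branching vertex has at least two successors.\<close>
  have "\<exists>d\<in>D. lam' * v d < sum v (nxt d)"
  proof (cases "lam' > 1")
    case True
    have "C \<noteq> {}" using cardE1 fewer_edges by auto
    then obtain d where d: "d \<in> D" "v d = 0 \<or> lam' * v d < sum v (nxt d)" using strict1 True by blast
    show ?thesis
    proof (rule ccontr)
      assume neg: "\<not> ?thesis"
      then have eq: "lam' * v e = sum v (nxt e)" if "e \<in> D" for e using sub1'[OF that] that by force
      have "\<exists>d\<in>D. v d > 0" using sub1 by (simp add: subinvariant_def)
      then have "v d > 0"
        using b1.subinvariant_positive[of lam' v d] eq v0 lam'(1) d(1) by (simp add: nxt_def)
      then show False using d neg by auto
    qed
  next
    case False
    then have one: "lam' = 1" "v = (\<lambda>_. 1)" using lam_v by auto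
    obtain f1 f2 f3 where f: "f1 \<in> D" "f2 \<in> D" "f3 \<in> D" "f1 \<noteq> f2" "f1 \<noteq> f3" "f2 \<noteq> f3"
      "(q \<circ> h.origin) f1 = (q \<circ> h.origin) f2" "(q \<circ> h.origin) f1 = (q \<circ> h.origin) f3"
      using b1.branch_dart by blast
    then have "{f2, f3} \<subseteq> nxt (flip_dart f1)"
      using b1.i_i[OF f(1)] by (auto simp: nxt_def nb_succ_def)
    then have "card {f2, f3} \<le> card (nxt (flip_dart f1))"
      using b1.finite_succ by (intro card_mono) (simp_all add: nxt_def)
    then have "lam' * v (flip_dart f1) < sum v (nxt (flip_dart f1))" using f(6) by (simp add: one)
    then show ?thesis using b1.i_closed[OF f(1)] by blast
  qed
  then have "\<exists>\<mu> > lam'. \<exists>u. (\<forall>d\<in>D. u d \<ge> 0 \<and> \<mu> * u d \<le> sum u (nxt d)) \<and> (\<exists>d\<in>D. u d > 0)"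
    using b1.subinvariant_improve[of lam' v] v0 sub1' lam'(1) unfolding nxt_def by simp
  then obtain \<mu> u where \<mu>: "\<mu> > lam'"
    and u: "\<And>d. d \<in> D \<Longrightarrow> u d \<ge> 0" "\<And>d. d \<in> D \<Longrightarrow> \<mu> * u d \<le> sum u (nxt d)" "\<exists>d\<in>D. u d > 0"
    by metis
  \<comment> \<open>The surviving darts of the old core are carried to the darts of the new one by
    the isomorphism of the collapse, with orientation kept.\<close>
  define F where "F d = (iso_arcs f (fst d), snd d)" for d :: "('x word set, 'x) arc \<times> bool"
  have bij_F: "bij_betw F D h1.darts"
    unfolding bij_betw_def
  proof
    show "inj_on F D"
      using inj_arcs by (auto simp: inj_on_def F_def D_def)
    show "F ` D = h1.darts"
      unfolding E1 by (force simp: F_def D_def)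
  qed
  have flip_F: "flip_dart (F d) = F (flip_dart d)" for d by (simp add: F_def flip_dart_def)
  have FD: "F d \<in> h1.darts" if "d \<in> D" for d using bij_F that by (auto simp: bij_betw_def)
  have DV: "h.origin d \<in> ?V" if "d \<in> D" for d
    using that wf_digraph.tail_in_verts[OF h.wf_core] wf_digraph.head_in_verts[OF h.wf_core]
    by (auto simp: D_def dart_tail_def)
  have origin_F: "h1.origin (F d) = iso_verts f (connected_via ?G C `` {h.origin d})" if "d \<in> D" for d
    using that tail_f head_f unfolding core1 by (auto simp: D_def F_def dart_tail_def)
  have origin_eq: "h1.origin (F d) = h1.origin (F d') \<longleftrightarrow> (q \<circ> h.origin) d = (q \<circ> h.origin) d'"
    if "d \<in> D" "d' \<in> D" for d d'
  proof -
    have "connected_via ?G C `` {h.origin e} \<in> ?V // connected_via ?G C" if "e \<in> D" for e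
      using DV[OF that] by (rule quotientI)
    then have "h1.origin (F d) = h1.origin (F d') \<longleftrightarrow>
        connected_via ?G C `` {h.origin d} = connected_via ?G C `` {h.origin d'}"
      using origin_F that inj_verts by (simp add: inj_on_eq_iff)
    then show ?thesis using class_q(2) DV that by simp
  qed
  have nxt_F: "F d' \<in> nb_succ h1.darts flip_dart h1.origin (F d) \<longleftrightarrow> d' \<in> nxt d"
    if "d \<in> D" "d' \<in> D" for d d'
  proof -
    have fl: "flip_dart d \<in> D" by (rule b1.i_closed[OF that(1)])
    have "F d' = F (flip_dart d) \<longleftrightarrow> d' = flip_dart d"
      using bij_F that(2) fl by (auto simp: bij_betw_def inj_on_eq_iff)
    then show ?thesis
      unfolding nb_succ_def nxt_def mem_Collect_eq flip_F
      using origin_eq[OF that(2) fl] FD that by simp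
  qed
  have "\<mu> \<le> lam\<^sub>1"
  proof (rule perron_maximal[OF adj_M\<^sub>1 PF_M\<^sub>1, of "h1.dart_state \<circ> F" D nxt u])
    show "bij_betw (h1.dart_state \<circ> F) D (verts (transition_diagram (automaton_B (\<phi> ` H))))"
      by (rule bij_betw_trans[OF bij_F h1.bij_dart_state])
    show "nxt d \<subseteq> D" for d by (simp add: nxt_def nb_succ_subset)
    show "card {e \<in> arcs (transition_diagram (automaton_B (\<phi> ` H))).
        tail (transition_diagram (automaton_B (\<phi> ` H))) e = (h1.dart_state \<circ> F) d \<and>
        head (transition_diagram (automaton_B (\<phi> ` H))) e = (h1.dart_state \<circ> F) d'} =
        (if d' \<in> nxt d then 1 else 0)" if "d \<in> D" "d' \<in> D" for d d'
      using h1.card_transitions[OF FD[OF that(1)] FD[OF that(2)]] nxt_F[OF that] by simp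
  qed (use u in auto)
  then show ?thesis using \<mu> lam'(2) by linarith
qed

end
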